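(* Let $\delta>0$, $G_1(x)=x-\delta$, $G_2(x)=x+\delta$, and assume the integrability and limit conditions of the Dynkin game hold. Assume that for some $0\le\pi_I<1$, $0\le\pi_S<1$ and $r_I,r_S>0$ (with $-r_I<0<r_S$ the two roots of $\Psi(z)=r$), the infimum $I$ and supremum $S$ satisfy $$\mathbb E e^{zI}=\pi_I+(1-\pi_I)\frac{r_I}{r_I+z},\qquad \mathbb E e^{zS}=\pi_S+(1-\pi_S)\frac{r_S}{r_S-z},$$ i.e. $-I$ and $S$ have laws $\pi_I\delta_0+(1-\pi_I)\mathrm{Exp}(r_I)$ and $\pi_S\delta_0+(1-\pi_S)\mathrm{Exp}(r_S)$. Define $$E_I=\tfrac{1-\pi_I}{r_I},\ E_S=\tfrac{1-\pi_S}{r_S},\ F_I=\tfrac{r_I+r_S}{r_I+\pi_Ir_S},\ F_S=\tfrac{r_I+r_S}{\pi_Sr_I+r_S},\ G_I=F_I-1,\ G_S=F_S-1.$$ Then the equation in $u$ $$u-2\delta-E_I-E_S=\frac{-E_IF_Se^{r_Su}-E_SF_Ie^{r_Iu}+2E_SF_SG_I}{e^{(r_I+r_S)u}-G_IG_S}$$ has a unique positive solution $u$. With this $u$, set $$A_I=\frac{-E_Ie^{r_Su}+E_SG_I}{e^{(r_I+r_S)u}-G_IG_S},\qquad A_S=\frac{E_Se^{r_Iu}-E_IG_S}{e^{(r_I+r_S)u}-G_IG_S},$$ $$x_I=-\delta-E_I+F_IA_S,\qquad x_S=\delta+E_S+F_SA_I\quad(\text{so }x_S-x_I=u).$$ Then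 the Dynkin game with payoffs $G_1,G_2$ has optimal stopping times $\sigma^*=\inf\{t\ge0:X_t\le x_I\}$, $\tau^*=\inf\{t\ge0:X_t\ge x_S\}$ and value function $$V(x)=\begin{cases}x+\delta,& x\le x_I,\\ A_Ie^{-r_I(x-x_S)}+A_Se^{r_S(x-x_I)},& x_I\le x\le x_S,\\ x-\delta,& x\ge x_S,\end{cases}$$ that is, $V(x)=\inf_\sigma\sup_\tau M_x(\sigma,\tau)=\sup_\tau\inf_\sigma M_x(\sigma,\tau)=M_x(\sigma^*,\tau^* )$.
   Context: Let $X=(X_t)_{t\ge0}$ be a Lévy process with characteristic exponent $\Psi$ (so $\mathbb E e^{zX_t}=e^{t\Psi(z)}$), on a filtered probability space satisfying the usual conditions, with $X_0=x$ under $\mathbb P_x$. Stopping times take values in $[0,\infty]$. Fix $r>0$; for continuous $G_1\le G_2$ with $\mathbb E_x\sup_{t\ge0}|e^{-rt}G_i(X_t)|<\infty$ and $e^{-rt}G_i(X_t)\to0$ a.s. (the integrability and limit conditions), with convention $e^{-r\tau}G_i(X_\tau)=0$ on $\{\tau=\infty\}$, define $M_x(\sigma,\tau)=\mathbb E_x\big(e^{-r\tau}G_1(X_\tau)\mathbf 1_{\{\tau\le\sigma\}}+e^{-r\sigma}G_2(X_\sigma)\mathbf 1_{\{\sigma<\tau\}}\big)$. Let $e_r$ be exponential with parameter $r$, independent of $X$, $I=\inf_{0\le t\le e_r}X_t$, $S=\sup_{0\le t\le e_r}X_t$ under $\mathbb P=\mathbb P_0$. *)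

theory Defs
  imports "HOL-Probability.Probability"
begin

definition filtered_usual :: "'a measure \<Rightarrow> (real \<Rightarrow> 'a measure) \<Rightarrow> bool" where
  "filtered_usual M F \<longleftrightarrow> prob_space M
     \<and> (\<forall>t\<ge>0. space (F t) = space M \<and> sets (F t) \<subseteq> sets M)
     \<and> (\<forall>s t. 0 \<le> s \<longrightarrow> s \<le> t \<longrightarrow> sets (F s) \<subseteq> sets (F t))
     \<and> (\<forall>t\<ge>0. sets (F t) = (\<Inter>u\<in>{t<..}. sets (F u)))
     \<and> (\<forall>A. A \<subseteq> space M \<longrightarrow> (\<exists>N\<in>sets M. A \<subseteq> N \<and> emeasure M N = 0) \<longrightarrow> A \<in> sets (F 0))"

definition levy_process :: "'a measure \<Rightarrow> (real \<Rightarrow> 'a measure) \<Rightarrow> (real \<Rightarrow> 'a \<Rightarrow> real) \<Rightarrow> bool" where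
  "levy_process M F X \<longleftrightarrow> filtered_usual M F
     \<and> (\<forall>\<omega>\<in>space M. X 0 \<omega> = 0)
     \<and> (\<forall>t\<ge>0. X t \<in> borel_measurable (F t))
     \<and> (\<forall>\<omega>\<in>space M. \<forall>t\<ge>0. continuous (at_right t) (\<lambda>s. X s \<omega>)
            \<and> (t > 0 \<longrightarrow> (\<exists>l. ((\<lambda>s. X s \<omega>) \<longlongrightarrow> l) (at_left t))))
     \<and> (\<forall>s\<ge>0. \<forall>t\<ge>0.
          prob_space.indep_set M (sets (F t))
            {(\<lambda>\<omega>. X (t + s) \<omega> - X t \<omega>) -` B \<inter> space M | B. B \<in> sets borel}
        \<and> distr M borel (\<lambda>\<omega>. X (t + s) \<omega> - X t \<omega>) = distr M borel (X s))"

definition stopping_time_ext :: "(real \<Rightarrow> 'a measure) \<Rightarrow> ('a \<Rightarrow> ereal) \<Rightarrow> bool" where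
  "stopping_time_ext F \<tau> \<longleftrightarrow> (\<forall>\<omega>\<in>space (F 0). 0 \<le> \<tau> \<omega>)
     \<and> (\<forall>t\<ge>0. {\<omega>\<in>space (F t). \<tau> \<omega> \<le> ereal t} \<in> sets (F t))"

text \<open>e^{-r tau} G(X_tau) under P_x (X_0 = x realised as x + X), = 0 on {tau = oo}.\<close>
definition disc_payoff :: "real \<Rightarrow> (real \<Rightarrow> real) \<Rightarrow> (real \<Rightarrow> 'a \<Rightarrow> real) \<Rightarrow> real \<Rightarrow> ('a \<Rightarrow> ereal) \<Rightarrow> 'a \<Rightarrow> real" where
  "disc_payoff r G X x \<tau> \<omega> =
     (if \<tau> \<omega> = \<infinity> then 0
      else exp (- r * real_of_ereal (\<tau> \<omega>)) * G (x + X (real_of_ereal (\<tau> \<omega>)) \<omega>))"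

definition dynkin_M :: "'a measure \<Rightarrow> (real \<Rightarrow> 'a \<Rightarrow> real) \<Rightarrow> real \<Rightarrow> (real \<Rightarrow> real) \<Rightarrow> (real \<Rightarrow> real)
     \<Rightarrow> real \<Rightarrow> ('a \<Rightarrow> ereal) \<Rightarrow> ('a \<Rightarrow> ereal) \<Rightarrow> real" where
  "dynkin_M M X r G1 G2 x \<sigma> \<tau> =
     (\<integral>\<omega>. (if \<tau> \<omega> \<le> \<sigma> \<omega> then disc_payoff r G1 X x \<tau> \<omega> else disc_payoff r G2 X x \<sigma> \<omega>) \<partial>M)"

definition dynkin_conditions :: "'a measure \<Rightarrow> (real \<Rightarrow> 'a \<Rightarrow> real) \<Rightarrow> real \<Rightarrow> (real \<Rightarrow> real) \<Rightarrow> bool" where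
  "dynkin_conditions M X r G \<longleftrightarrow> (\<forall>x.
      (\<integral>\<^sup>+\<omega>. (SUP t\<in>{0..}. ennreal \<bar>exp (- r * t) * G (x + X t \<omega>)\<bar>) \<partial>M) < \<infinity>
    \<and> (AE \<omega> in M. ((\<lambda>t. exp (- r * t) * G (x + X t \<omega>)) \<longlongrightarrow> 0) at_top))"

definition hit_below :: "(real \<Rightarrow> 'a \<Rightarrow> real) \<Rightarrow> real \<Rightarrow> real \<Rightarrow> 'a \<Rightarrow> ereal" where
  "hit_below X x a \<omega> = (if \<exists>t\<ge>0. x + X t \<omega> \<le> a then ereal (Inf {t. 0 \<le> t \<and> x + X t \<omega> \<le> a}) else \<infinity>)"

definition hit_above :: "(real \<Rightarrow> 'a \<Rightarrow> real) \<Rightarrow> real \<Rightarrow> real \<Rightarrow> 'a \<Rightarrow> ereal" where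
  "hit_above X x a \<omega> = (if \<exists>t\<ge>0. x + X t \<omega> \<ge> a then ereal (Inf {t. 0 \<le> t \<and> x + X t \<omega> \<ge> a}) else \<infinity>)"

end

theory Submission
  imports Defs
begin

text \<open>
  Write \<open>Q(y) = y - E\<^sub>S - \<delta> - F\<^sub>S A\<^sub>I exp (-r\<^sub>I (y - x\<^sub>S))\<close> for \<open>y \<ge> x\<^sub>S\<close> and \<open>Q(y) = 0\<close> below.
  The definition of \<open>x\<^sub>S\<close> says that \<open>Q\<close> is continuous, and \<open>r\<^sub>I F\<^sub>S |A\<^sub>I| \<le> 1\<close> makes it nondecreasing.
  With the mirror image \<open>Q'\<close> of \<open>Q\<close> at \<open>x\<^sub>I\<close>, the value function is
  \<open>V(x) = E Q(x + S) - E Q'(x + I)\<close>. Since the supremum over \<open>[t, e\<^sub>r]\<close> is at most the one over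
  \<open>[0, e\<^sub>r]\<close>, the discounted first term is a supermartingale, and it is a martingale up to the first
  passage above \<open>x\<^sub>S\<close>, before which the discarded part of the path does not contribute. Likewise for
  the second term and \<open>x\<^sub>I\<close>. So \<open>V\<close> is a supermartingale up to \<open>\<sigma>\<^sup>*\<close> and a submartingale up to
  \<open>\<tau>\<^sup>*\<close>, and \<open>G\<^sub>1 \<le> V \<le> G\<^sub>2\<close> gives the saddle point. The second half is the first half applied to
  \<open>-X\<close>.

  The equation for \<open>u\<close> says \<open>x\<^sub>S - x\<^sub>I = u\<close>. It has one solution since \<open>u - (x\<^sub>S - x\<^sub>I)\<close> has the
  derivative \<open>(1 - r\<^sub>S F\<^sub>I A\<^sub>S) (1 - r\<^sub>I F\<^sub>S |A\<^sub>I|)\<close>, both factors of which are positive.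

  Optional sampling is proved on time grids of mesh \<open>h\<close>, where it reduces to the independence of a
  single increment from the past, and carried over by right-continuity of the paths as \<open>h\<close> tends to
  \<open>0\<close>.
\<close>

lemma saddle_point_minimax:
  fixes K :: "'a \<Rightarrow> 'b \<Rightarrow> 'c :: conditionally_complete_lattice"
  assumes s: "s \<in> A" and t: "t \<in> B"
    and upper: "\<And>y. y \<in> B \<Longrightarrow> K s y \<le> v" and lower: "\<And>x. x \<in> A \<Longrightarrow> v \<le> K x t"
    and bdd_above: "\<And>x. x \<in> A \<Longrightarrow> bdd_above (K x ` B)"
    and bdd_below: "\<And>y. y \<in> B \<Longrightarrow> bdd_below ((\<lambda>x. K x y) ` A)"
  shows "v = (INF x\<in>A. SUP y\<in>B. K x y)" "v = (SUP y\<in>B. INF x\<in>A. K x y)" "v = K s t"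
proof -
  have SUP_ge: "v \<le> (SUP y\<in>B. K x y)" if "x \<in> A" for x
    using lower[OF that] cSUP_upper[OF t bdd_above[OF that]] by (rule order_trans)
  have INF_le: "(INF x\<in>A. K x y) \<le> v" if "y \<in> B" for y
    using cINF_lower[OF bdd_below[OF that] s] upper[OF that] by (rule order_trans)
  show "v = (INF x\<in>A. SUP y\<in>B. K x y)"
  proof (rule antisym)
    show "v \<le> (INF x\<in>A. SUP y\<in>B. K x y)"
      using s SUP_ge by (intro cINF_greatest) auto
    have "(INF x\<in>A. SUP y\<in>B. K x y) \<le> (SUP y\<in>B. K s y)"
      using SUP_ge by (intro cINF_lower s bdd_belowI2)
    also have "\<dots> \<le> v" using t upper by (intro cSUP_least) auto
    finally show "(INF x\<in>A. SUP y\<in>B. K x y) \<le> v" .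
  qed
  show "v = (SUP y\<in>B. INF x\<in>A. K x y)"
  proof (rule antisym)
    have "v \<le> (INF x\<in>A. K x t)" using s lower by (intro cINF_greatest) auto
    also have "\<dots> \<le> (SUP y\<in>B. INF x\<in>A. K x y)"
      using INF_le by (intro cSUP_upper t bdd_aboveI2)
    finally show "v \<le> (SUP y\<in>B. INF x\<in>A. K x y)" .
    show "(SUP y\<in>B. INF x\<in>A. K x y) \<le> v"
      using t INF_le by (intro cSUP_least) auto
  qed
  show "v = K s t" using upper[OF t] lower[OF s] by (rule antisym[rotated])
qed

section \<open>The equation for the length of the continuation interval\<close>

locale gap_equation =
  fixes rI rS \<pi>I \<pi>S \<delta> :: real
  assumes rI_pos: "rI > 0" and rS_pos: "rS > 0"
    and piI: "0 \<le> \<pi>I" "\<pi>I < 1" and piS: "0 \<le> \<pi>S" "\<pi>S < 1"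
    and delta_pos: "\<delta> > 0"
begin

definition EI :: real where "EI = (1 - \<pi>I) / rI"
definition ES :: real where "ES = (1 - \<pi>S) / rS"
definition FI :: real where "FI = (rI + rS) / (rI + \<pi>I * rS)"
definition FS :: real where "FS = (rI + rS) / (\<pi>S * rI + rS)"
definition GI :: real where "GI = (rI + rS) / (rI + \<pi>I * rS) - 1"
definition GS :: real where "GS = (rI + rS) / (\<pi>S * rI + rS) - 1"
definition AI :: "real \<Rightarrow> real" where
  "AI u = (- EI * exp (rS * u) + ES * GI) / (exp ((rI + rS) * u) - GI * GS)"
definition AS :: "real \<Rightarrow> real" where
  "AS u = (ES * exp (rI * u) - EI * GS) / (exp ((rI + rS) * u) - GI * GS)"
definition xI :: "real \<Rightarrow> real" where
  "xI u = - \<delta> - EI + FI * AS u"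
definition xS :: "real \<Rightarrow> real" where
  "xS u = \<delta> + ES + FS * AI u"

end

text \<open>Reflecting the real line exchanges the two players. A lemma of the locale is available in its
  mirrored form only once its context has been closed, hence the repeated reopening below.\<close>

sublocale gap_equation \<subseteq> mirror: gap_equation rS rI \<pi>S \<pi>I \<delta>
  rewrites "mirror.EI = ES" and "mirror.ES = EI" and "mirror.FI = FS" and "mirror.FS = FI"
    and "mirror.GI = GS" and "mirror.GS = GI"
    and "mirror.AI = (\<lambda>u. - AS u)" and "mirror.AS = (\<lambda>u. - AI u)"
    and "mirror.xI = (\<lambda>u. - xS u)" and "mirror.xS = (\<lambda>u. - xI u)"
proof -
  interpret mirror: gap_equation rS rI \<pi>S \<pi>I \<delta>
    using rI_pos rS_pos piI piS delta_pos by unfold_locales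
  show "gap_equation rS rI \<pi>S \<pi>I \<delta>" by unfold_locales
  show constants: "mirror.EI = ES" "mirror.ES = EI" "mirror.FI = FS" "mirror.FS = FI"
      "mirror.GI = GS" "mirror.GS = GI"
    by (simp_all add: mirror.EI_def mirror.ES_def mirror.FI_def mirror.FS_def mirror.GI_def
        mirror.GS_def EI_def ES_def FI_def FS_def GI_def GS_def add.commute)
  show coefficients: "mirror.AI = (\<lambda>u. - AS u)" "mirror.AS = (\<lambda>u. - AI u)"
    by (auto simp: fun_eq_iff mirror.AI_def mirror.AS_def AI_def AS_def constants minus_divide_left
        add.commute mult.commute[of GS])
  show "mirror.xI = (\<lambda>u. - xS u)" "mirror.xS = (\<lambda>u. - xI u)"
    by (simp_all add: fun_eq_iff mirror.xI_def mirror.xS_def xI_def xS_def constants coefficients)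
qed

context gap_equation
begin

lemma denom_pos: "rI + \<pi>I * rS > 0" "\<pi>S * rI + rS > 0"
  using rI_pos rS_pos piI piS by (simp_all add: add_pos_nonneg add_nonneg_pos)

lemma FI_pos: "FI > 0"
  using rI_pos rS_pos denom_pos by (simp add: FI_def)

lemma FI_eq: "FI = GI + 1"
  by (simp add: FI_def GI_def)

lemma GI_eq: "GI = rS * (1 - \<pi>I) / (rI + \<pi>I * rS)"
  using denom_pos by (simp add: GI_def field_simps)

lemma GI_pos: "GI > 0"
  using rS_pos piI denom_pos by (simp add: GI_eq)

lemma rS_minus_rI_GI: "rS - rI * GI = \<pi>I * (rS * FI)"
  using denom_pos by (simp add: GI_eq FI_def field_simps)

lemma rI_GI_le: "rI * GI \<le> rS"
  using rS_minus_rI_GI piI rS_pos FI_pos by (smt (verit) mult_nonneg_nonneg)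

end

context gap_equation
begin

lemma GI_GS_le_1: "GI * GS \<le> 1"
proof -
  have "(rI * GI) * (rS * GS) \<le> rS * rI"
    using rI_GI_le mirror.rI_GI_le GI_pos mirror.GI_pos rI_pos rS_pos by (intro mult_mono) auto
  then have "(rI * rS) * (GI * GS) \<le> (rI * rS) * 1" by (simp add: mult_ac)
  then show ?thesis using rI_pos rS_pos by (simp only: mult_le_cancel_left_pos mult_pos_pos)
qed

lemma gap_denom_pos: "exp ((rI + rS) * u) - GI * GS > 0" if "u > 0"
proof -
  have "exp ((rI + rS) * u) > 1" using rI_pos rS_pos that by simp
  then show ?thesis using GI_GS_le_1 by linarith
qed

lemma EI_FI: "rI * rS * (EI * FI) = (rI + rS) * GI"
  using rI_pos rS_pos denom_pos by (simp add: EI_def FI_def GI_eq)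

lemma ES_FS_GI: "ES * FS * GI = EI * FI * GS"
  using rI_pos rS_pos denom_pos
  by (simp add: EI_def ES_def FI_def FS_def GI_eq mirror.GI_eq ac_simps)

lemma EI_GS_le: "EI * GS \<le> ES"
proof -
  have "EI * GS = (1 - \<pi>I) * (1 - \<pi>S) / (rS + \<pi>S * rI)"
    using rI_pos by (simp add: EI_def mirror.GI_eq)
  also have "\<dots> \<le> (1 - \<pi>S) / rS"
    using rI_pos rS_pos piI piS by (intro frac_le) (auto simp: mult_left_le_one_le)
  finally show ?thesis by (simp add: ES_def)
qed

lemma ES_pos: "ES > 0"
  using piS rS_pos by (simp add: ES_def)

lemma AS_pos: "AS u > 0" if "u > 0"
proof -
  have "ES * 1 < ES * exp (rI * u)"
    using rI_pos ES_pos that by (intro mult_strict_left_mono) auto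
  then show ?thesis using EI_GS_le gap_denom_pos[OF that] by (simp add: AS_def)
qed

text \<open>The claim amounts to \<open>F\<^sub>I < exp (r\<^sub>S u) + G\<^sub>I exp (- r\<^sub>I u)\<close>. Both sides agree at \<open>u = 0\<close>, where
  the right-hand side has slope \<open>r\<^sub>S - r\<^sub>I G\<^sub>I \<ge> 0\<close>.\<close>

lemma FI_AS_less: "FI * AS u < ES" if "u > 0"
proof -
  define A B where "A = exp (rI * u)" and "B = exp (rS * u)"
  have AB: "A > 0" "exp ((rI + rS) * u) = A * B" by (auto simp: A_def B_def exp_add algebra_simps)
  have "1 + rS * u < B"
    unfolding B_def using exp_lower_Taylor_quadratic[of "rS * u"] rS_pos that
    by (smt (verit) mult_pos_pos zero_less_divide_iff zero_less_power)
  moreover have "GI * (1 - rI * u) \<le> GI * inverse A"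
    unfolding A_def exp_minus[symmetric] using exp_ge_add_one_self[of "- (rI * u)"] GI_pos
    by (intro mult_left_mono) auto
  moreover have "0 \<le> (rS - rI * GI) * u" using rI_GI_le that by simp
  ultimately have "FI < B + GI * inverse A" unfolding FI_eq by (simp add: algebra_simps)
  then have "FI * A < (B + GI * inverse A) * A" using AB(1) by (rule mult_strict_right_mono)
  also have "\<dots> = A * B + GI" using AB(1) by (simp add: distrib_right)
  finally have "FI * A - FS * GI < A * B - GI * GS"
    unfolding mirror.FI_eq by (simp add: algebra_simps)
  then have "ES * (FI * A - FS * GI) / (A * B - GI * GS) < ES"
    using ES_pos gap_denom_pos[OF that] unfolding AB by (simp add: pos_divide_less_eq)
  also have "ES * (FI * A - FS * GI) / (A * B - GI * GS) = FI * AS u"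
    unfolding AS_def AB A_def[symmetric] using ES_FS_GI by (simp add: algebra_simps)
  finally show ?thesis .
qed

lemma rS_FI_AS_less: "rS * (FI * AS u) < 1" if "u > 0"
proof -
  have "rS * (FI * AS u) < rS * ES" using FI_AS_less[OF that] rS_pos by (rule mult_strict_left_mono)
  also have "\<dots> \<le> 1" using rS_pos piS by (simp add: ES_def)
  finally show ?thesis .
qed

lemma gap_eq: "xS u - xI u = 2 * \<delta> + EI + ES
    + (- EI * FS * exp (rS * u) - ES * FI * exp (rI * u) + 2 * ES * FS * GI)
      / (exp ((rI + rS) * u) - GI * GS)"
proof -
  have "- EI * FS * exp (rS * u) - ES * FI * exp (rI * u) + 2 * ES * FS * GI
      = FS * (- EI * exp (rS * u) + ES * GI) - FI * (ES * exp (rI * u) - EI * GS)"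
    using ES_FS_GI by (simp add: algebra_simps)
  moreover have "(FS * x - FI * y) / D = FS * (x / D) - FI * (y / D)" for x y D
    by (simp add: diff_divide_distrib)
  ultimately show ?thesis by (simp only: xI_def xS_def AI_def AS_def)
qed

end

context gap_equation
begin

lemma gap_excess_has_derivative:
  assumes "u > 0"
  shows "((\<lambda>u. u - (xS u - xI u)) has_real_derivative
    (1 - rS * (FI * AS u)) * (1 - rI * (FS * - AI u))) (at u)"
proof -
  define A B D where "A = exp (rI * u)" and "B = exp (rS * u)" and "D = A * B - GI * GS"
  define N where "N = - EI * FS * B - ES * FI * A + 2 * ES * FS * GI"
  have AB: "exp ((rI + rS) * u) = A * B" by (simp add: A_def B_def exp_add algebra_simps)
  have D: "D \<noteq> 0" using gap_denom_pos[OF assms] by (simp add: D_def AB)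
  have "((\<lambda>u. - EI * FS * exp (rS * u) - ES * FI * exp (rI * u) + 2 * ES * FS * GI)
      has_real_derivative - EI * FS * (rS * B) - ES * FI * (rI * A)) (at u)"
    by (auto intro!: derivative_eq_intros simp: A_def B_def)
  moreover have "((\<lambda>u. exp ((rI + rS) * u) - GI * GS)
      has_real_derivative (rI + rS) * (A * B)) (at u)"
    by (auto intro!: derivative_eq_intros simp: AB)
  ultimately have quotient: "((\<lambda>u. (- EI * FS * exp (rS * u) - ES * FI * exp (rI * u) + 2 * ES * FS * GI)
        / (exp ((rI + rS) * u) - GI * GS)) has_real_derivative
      ((- EI * FS * (rS * B) - ES * FI * (rI * A)) * D - N * ((rI + rS) * (A * B))) / (D * D)) (at u)"
    using DERIV_divide[where s=UNIV] D
    by (fastforce simp: AB A_def[symmetric] B_def[symmetric] D_def N_def)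
  have "((\<lambda>u. u - (xS u - xI u)) has_real_derivative
      1 - ((- EI * FS * (rS * B) - ES * FI * (rI * A)) * D - N * ((rI + rS) * (A * B))) / (D * D)) (at u)"
    unfolding gap_eq
    using DERIV_diff[OF DERIV_ident DERIV_add[OF DERIV_const quotient, of "2 * \<delta> + EI + ES"]]
    by simp
  also have "1 - ((- EI * FS * (rS * B) - ES * FI * (rI * A)) * D - N * ((rI + rS) * (A * B))) / (D * D)
     = (D - rS * (FI * (ES * A - EI * GS))) * (D - rI * (FS * (EI * B - ES * GI))) / (D * D)"
  proof -
    have "D * D - ((- EI * FS * (rS * B) - ES * FI * (rI * A)) * D - N * ((rI + rS) * (A * B)))
      = (D - rS * (FI * (ES * A - EI * GS))) * (D - rI * (FS * (EI * B - ES * GI)))"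
      using EI_FI ES_FS_GI D_def N_def by algebra
    then show ?thesis using D by (simp add: field_simps)
  qed
  also have "\<dots> = (1 - rS * (FI * AS u)) * (1 - rI * (FS * - AI u))"
    using D unfolding AS_def AI_def AB A_def[symmetric] B_def[symmetric] D_def[symmetric]
    by (simp add: field_simps)
  finally show ?thesis .
qed

lemma gap_excess_strict_mono:
  assumes "0 < u" "u < v"
  shows "u - (xS u - xI u) < v - (xS v - xI v)"
proof (rule DERIV_pos_imp_increasing[OF assms(2)])
  fix x assume "u \<le> x" "x \<le> v"
  then have x: "x > 0" using assms by linarith
  have "(1 - rS * (FI * AS x)) * (1 - rI * (FS * - AI x)) > 0"
    using rS_FI_AS_less[OF x] mirror.rS_FI_AS_less[OF x] by simp
  then show "\<exists>d. ((\<lambda>u. u - (xS u - xI u)) has_real_derivative d) (at x) \<and> d > 0"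
    using gap_excess_has_derivative[OF x] by blast
qed

lemma ex1_gap: "\<exists>!u. u > 0 \<and> xS u - xI u = u"
proof -
  define w where "w = 2 * \<delta> + EI + ES"
  have w: "\<delta> \<le> w" using delta_pos ES_pos mirror.ES_pos by (simp add: w_def)
  have "\<exists>u\<ge>\<delta>. u \<le> w \<and> u - (xS u - xI u) = 0"
  proof (rule IVT'[OF _ _ w])
    show "\<delta> - (xS \<delta> - xI \<delta>) \<le> 0"
      using FI_AS_less[OF delta_pos] mirror.FI_AS_less[OF delta_pos] delta_pos
      by (simp add: xI_def xS_def)
    show "0 \<le> w - (xS w - xI w)"
      using mult_pos_pos[OF FI_pos AS_pos, of w] mult_pos_pos[OF mirror.FI_pos mirror.AS_pos, of w]
        w delta_pos
      by (simp add: xI_def xS_def w_def)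
    show "continuous_on {\<delta>..w} (\<lambda>u. u - (xS u - xI u))"
    proof (intro continuous_at_imp_continuous_on ballI)
      fix x assume "x \<in> {\<delta>..w}"
      then have "x > 0" using delta_pos by simp
      then show "isCont (\<lambda>u. u - (xS u - xI u)) x"
        by (rule DERIV_isCont[OF gap_excess_has_derivative])
    qed
  qed
  then obtain u where u: "u > 0" "u - (xS u - xI u) = 0" using delta_pos by (meson less_le_trans)
  show ?thesis
  proof (rule ex1I[of _ u])
    fix v assume "v > 0 \<and> xS v - xI v = v"
    then show "v = u"
      using gap_excess_strict_mono[of u v] gap_excess_strict_mono[of v u] u
      by (cases v u rule: linorder_cases) auto
  qed (use u in simp)
qed

lemma AS_exp: "AS u * exp (rS * u) = ES + GS * AI u" if "u > 0"
proof -
  let ?D = "exp ((rI + rS) * u) - GI * GS"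
  have AI: "AI u * ?D = - EI * exp (rS * u) + ES * GI"
    and AS: "AS u * ?D = ES * exp (rI * u) - EI * GS"
    using gap_denom_pos[OF that] by (simp_all add: AI_def AS_def)
  have "exp (rI * u) * exp (rS * u) = ?D + GI * GS" by (simp add: exp_add algebra_simps)
  with AI AS have "AS u * exp (rS * u) * ?D = (ES + GS * AI u) * ?D" by algebra
  then show ?thesis using gap_denom_pos[OF that] by simp
qed

end

section \<open>Right-continuous paths with left limits\<close>

definition cadlag :: "(real \<Rightarrow> real) \<Rightarrow> bool" where
  "cadlag f \<longleftrightarrow> (\<forall>t\<ge>0. continuous (at_right t) f \<and> (t > 0 \<longrightarrow> (\<exists>l. (f \<longlongrightarrow> l) (at_left t))))"

lemma cadlag_tendsto_from_right:
  assumes "cadlag f" "t \<ge> 0" "s \<longlonglongrightarrow> t" "\<And>n. t \<le> s n"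
  shows "(\<lambda>n. f (s n)) \<longlonglongrightarrow> f t"
proof -
  have "continuous (at t within {t..}) f"
    using assms(1,2) by (simp add: cadlag_def continuous_within at_within_Ici_at_right)
  then show ?thesis
    using assms(3,4) unfolding continuous_within_sequentially by (auto simp: o_def)
qed

lemma cadlag_locally_bdd_above:
  assumes f: "cadlag f" and "x \<ge> 0"
  obtains c where "eventually (\<lambda>s. 0 \<le> s \<longrightarrow> f s \<le> c) (nhds x)"
proof -
  have right: "eventually (\<lambda>s. f s < f x + 1) (at_right x)"
    using f \<open>x \<ge> 0\<close> by (intro order_tendstoD(2)[of f "f x"])
      (auto simp: cadlag_def continuous_within)
  obtain l where left: "eventually (\<lambda>s. 0 \<le> s \<longrightarrow> f s \<le> l) (at_left x)"
  proof (cases "x = 0")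
    case True
    show thesis by (rule that[of 0]) (auto simp: True eventually_at_filter)
  next
    case False
    then obtain l where "(f \<longlongrightarrow> l) (at_left x)" using f \<open>x \<ge> 0\<close> by (auto simp: cadlag_def)
    then have "eventually (\<lambda>s. f s < l + 1) (at_left x)" by (rule order_tendstoD) simp
    then show thesis by (intro that[of "l + 1"]) (auto intro: eventually_mono)
  qed
  have "eventually (\<lambda>s. 0 \<le> s \<longrightarrow> f s \<le> max l (f x + 1)) (at x)"
    unfolding eventually_at_split
    by (intro conjI eventually_mono[OF left] eventually_mono[OF right]) auto
  then show thesis
    by (intro that[of "max l (f x + 1)"]) (auto simp: eventually_nhds_conv_at)
qed

lemma cadlag_bdd_above:
  assumes "cadlag f"
  shows "bdd_above (f ` {0..T})"
proof (cases "0 \<le> T")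
  case True
  define P where "P a b \<longleftrightarrow> bdd_above (f ` ({a..b} \<inter> {0..}))" for a b
  from True have "P 0 T"
  proof (induction rule: Bolzano)
    case (trans a b c)
    then have "{a..c} = {a..b} \<union> {b..c}" by auto
    then show ?case using trans by (simp add: P_def image_Un Int_Un_distrib2)
  next
    case (local x)
    obtain c where "eventually (\<lambda>s. 0 \<le> s \<longrightarrow> f s \<le> c) (nhds x)"
      using cadlag_locally_bdd_above[OF assms local(1)] .
    then obtain d where "d > 0" and d: "\<And>s. dist s x < d \<Longrightarrow> 0 \<le> s \<Longrightarrow> f s \<le> c"
      unfolding eventually_nhds_metric by blast
    have "P a b" if "a \<le> x" "x \<le> b" "b - a < d" for a b
      unfolding P_def using that by (intro bdd_aboveI2[of _ _ c] d) (auto simp: dist_real_def)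
    then show ?case using \<open>d > 0\<close> by blast
  qed
  moreover have "{0..T} \<inter> {0..} = {0..T}" by auto
  ultimately show ?thesis by (simp add: P_def)
qed simp

lemma cadlag_le_Sup: "cadlag f \<Longrightarrow> 0 \<le> s \<Longrightarrow> s \<le> T \<Longrightarrow> f s \<le> (SUP s\<in>{0..T}. f s)"
  by (intro cSUP_upper cadlag_bdd_above) auto

lemma less_cadlag_Sup_iff_Rats:
  assumes f: "cadlag f" and T: "T \<ge> 0"
  shows "c < (SUP s\<in>{0..T}. f s) \<longleftrightarrow> (\<exists>q\<in>\<rat> \<inter> {0..1}. c < f (q * T))"
proof
  assume "c < (SUP s\<in>{0..T}. f s)"
  then obtain s where s: "0 \<le> s" "s \<le> T" "c < f s"
    using T by (subst (asm) less_cSUP_iff[OF _ cadlag_bdd_above[OF f]]) auto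
  show "\<exists>q\<in>\<rat> \<inter> {0..1}. c < f (q * T)"
  proof (cases "s = T")
    case True
    then show ?thesis using s by (intro bexI[of _ 1]) auto
  next
    case False
    then have sT: "s < T" using s by simp
    have "eventually (\<lambda>v. c < f v) (at_right s)"
      using f s by (intro order_tendstoD(1)[of f "f s"]) (auto simp: cadlag_def continuous_within)
    then obtain d where d: "s < d" "\<And>v. s < v \<Longrightarrow> v < d \<Longrightarrow> c < f v"
      unfolding eventually_at_right_field by blast
    obtain q where "q \<in> \<rat>" "s / T < q" "q < min d T / T"
      using Rats_dense_in_real[of "s / T" "min d T / T"] d sT s
      by (auto simp: divide_strict_right_mono)
    then have q: "q \<in> \<rat>" "s < q * T" "q * T < d" "q * T < T"
      using s sT by (simp_all add: pos_divide_less_eq pos_less_divide_eq)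
    moreover have "0 \<le> q" "q \<le> 1"
      using q s sT zero_less_mult_pos2[of q T] by simp_all
    ultimately show ?thesis using d(2)[of "q * T"] by (intro bexI[of _ q]) auto
  qed
next
  assume "\<exists>q\<in>\<rat> \<inter> {0..1}. c < f (q * T)"
  then obtain q where q: "0 \<le> q" "q \<le> 1" "c < f (q * T)" by auto
  note q(3)
  also have "f (q * T) \<le> (SUP s\<in>{0..T}. f s)"
    using T q by (intro cadlag_le_Sup[OF f]) (auto simp: mult_left_le_one_le)
  finally show "c < (SUP s\<in>{0..T}. f s)" .
qed

lemma grid_ceiling_bounds:
  fixes h t :: real
  assumes "h > 0" "t \<ge> 0"
  shows "t \<le> real (nat \<lceil>t / h\<rceil>) * h" "real (nat \<lceil>t / h\<rceil>) * h \<le> t + h"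
proof -
  have "real (nat \<lceil>t / h\<rceil>) = real_of_int \<lceil>t / h\<rceil>" using assms by simp
  then have "t / h \<le> real (nat \<lceil>t / h\<rceil>)" "real (nat \<lceil>t / h\<rceil>) \<le> t / h + 1" by linarith+
  then show "t \<le> real (nat \<lceil>t / h\<rceil>) * h" "real (nat \<lceil>t / h\<rceil>) * h \<le> t + h"
    using assms(1) by (simp_all add: field_simps)
qed

lemma grid_ceiling_tendsto:
  fixes t :: real
  assumes "t \<ge> 0" and h: "\<And>n. h n > 0" "h \<longlonglongrightarrow> 0"
  shows "(\<lambda>n. real (nat \<lceil>t / h n\<rceil>) * h n) \<longlonglongrightarrow> t"
proof (rule tendsto_sandwich[OF _ _ tendsto_const])
  show "(\<lambda>n. t + h n) \<longlonglongrightarrow> t" using tendsto_add[OF tendsto_const h(2), of t] by simp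
qed (use grid_ceiling_bounds[OF h(1) \<open>t \<ge> 0\<close>] in auto)

lemma cadlag_grid_ceiling_tendsto:
  assumes "cadlag f" "t \<ge> 0" "\<And>n. h n > 0" "h \<longlonglongrightarrow> 0"
  shows "(\<lambda>n. f (real (nat \<lceil>t / h n\<rceil>) * h n)) \<longlonglongrightarrow> f t"
  by (rule cadlag_tendsto_from_right[OF assms(1,2) grid_ceiling_tendsto[OF assms(2-4)]
        grid_ceiling_bounds(1)[OF assms(3,2)]])

lemma cadlag_grid_Max_tendsto:
  assumes f: "cadlag f" and T: "T \<ge> 0" and h: "\<And>n. h n > 0" "h \<longlonglongrightarrow> 0"
  shows "(\<lambda>n. MAX j\<in>{..nat \<lceil>T / h n\<rceil>}. f (real j * h n)) \<longlonglongrightarrow> (SUP s\<in>{0..T}. f s)"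
    (is "?max \<longlonglongrightarrow> ?sup")
proof (rule order_tendstoI)
  fix c assume "c < ?sup"
  then obtain t where t: "0 \<le> t" "t \<le> T" "c < f t"
    using T by (subst (asm) less_cSUP_iff[OF _ cadlag_bdd_above[OF f]]) auto
  have "eventually (\<lambda>n. c < f (real (nat \<lceil>t / h n\<rceil>) * h n)) sequentially"
    using cadlag_grid_ceiling_tendsto[OF f t(1) h] t(3) by (rule order_tendstoD)
  then show "eventually (\<lambda>n. c < ?max n) sequentially"
  proof eventually_elim
    case (elim n)
    have "nat \<lceil>t / h n\<rceil> \<le> nat \<lceil>T / h n\<rceil>"
      using t h(1)[of n] by (intro nat_mono ceiling_mono divide_right_mono) auto
    then have "f (real (nat \<lceil>t / h n\<rceil>) * h n) \<le> ?max n" by (intro Max_ge) auto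
    then show ?case using elim by simp
  qed
next
  fix c assume c: "?sup < c"
  have "f T \<le> ?sup" using T by (intro cadlag_le_Sup[OF f]) auto
  then have "eventually (\<lambda>n. f (real (nat \<lceil>T / h n\<rceil>) * h n) < c) sequentially"
    using c by (intro order_tendstoD(2)[OF cadlag_grid_ceiling_tendsto[OF f T h]]) auto
  then show "eventually (\<lambda>n. ?max n < c) sequentially"
  proof eventually_elim
    case (elim n)
    have "f (real j * h n) < c" if "j < nat \<lceil>T / h n\<rceil>" for j
    proof -
      have "real j < T / h n" using that by linarith
      then have "real j * h n \<le> T" using h(1)[of n] by (simp add: field_simps)
      then show ?thesis using cadlag_le_Sup[OF f, of "real j * h n" T] h(1)[of n] c by simp
    qed
    then show ?case using elim by (auto simp: le_less)
  qed
qed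

section \<open>Independence and killed random walks\<close>

lemma (in prob_space) indep_set_mono:
  assumes "indep_set \<A> \<B>" "\<A>' \<subseteq> \<A>" "\<B>' \<subseteq> \<B>"
  shows "indep_set \<A>' \<B>'"
  using assms unfolding indep_sets2_eq by (meson order_trans subsetD)

lemma (in prob_space) indep_set_nn_integral:
  assumes ind: "indep_set \<A> \<B>"
    and Z[measurable]: "Z \<in> measurable M N" and Y[measurable]: "Y \<in> measurable M K"
    and ZA: "\<And>A. A \<in> sets N \<Longrightarrow> Z -` A \<inter> space M \<in> \<A>"
    and YB: "\<And>B. B \<in> sets K \<Longrightarrow> Y -` B \<inter> space M \<in> \<B>"
    and f[measurable]: "f \<in> borel_measurable (N \<Otimes>\<^sub>M K)"
  shows "(\<integral>\<^sup>+\<omega>. f (Z \<omega>, Y \<omega>) \<partial>M) = (\<integral>\<^sup>+\<omega>. \<integral>\<^sup>+\<omega>'. f (Z \<omega>, Y \<omega>') \<partial>M \<partial>M)"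
proof -
  interpret Z: prob_space "distr M N Z" by (rule prob_space_distr) fact
  interpret Y: prob_space "distr M K Y" by (rule prob_space_distr) fact
  have joint: "distr M N Z \<Otimes>\<^sub>M distr M K Y = distr M (N \<Otimes>\<^sub>M K) (\<lambda>x. (Z x, Y x))"
  proof (rule pair_measure_eqI)
    fix A B assume "A \<in> sets (distr M N Z)" "B \<in> sets (distr M K Y)"
    then have AB[measurable]: "A \<in> sets N" "B \<in> sets K" by auto
    have "emeasure (distr M (N \<Otimes>\<^sub>M K) (\<lambda>x. (Z x, Y x))) (A \<times> B)
        = emeasure M ((Z -` A \<inter> space M) \<inter> (Y -` B \<inter> space M))"
      by (subst emeasure_distr) (auto intro!: arg_cong[where f="emeasure M"])
    also have "\<dots> = ennreal (prob (Z -` A \<inter> space M) * prob (Y -` B \<inter> space M))"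
      unfolding emeasure_eq_measure by (simp add: indep_setD[OF ind ZA YB] AB)
    finally show "emeasure (distr M N Z) A * emeasure (distr M K Y) B
        = emeasure (distr M (N \<Otimes>\<^sub>M K) (\<lambda>x. (Z x, Y x))) (A \<times> B)"
      by (simp add: emeasure_distr emeasure_eq_measure ennreal_mult)
  qed (simp_all add: Z.sigma_finite_measure_axioms Y.sigma_finite_measure_axioms)
  have "(\<integral>\<^sup>+\<omega>. f (Z \<omega>, Y \<omega>) \<partial>M) = (\<integral>\<^sup>+p. f p \<partial>(distr M N Z \<Otimes>\<^sub>M distr M K Y))"
    unfolding joint by (subst nn_integral_distr) auto
  also have "\<dots> = (\<integral>\<^sup>+z. \<integral>\<^sup>+y. f (z, y) \<partial>distr M K Y \<partial>distr M N Z)"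
    by (rule Y.nn_integral_fst[symmetric]) simp
  also have "\<dots> = (\<integral>\<^sup>+\<omega>. \<integral>\<^sup>+y. f (Z \<omega>, y) \<partial>distr M K Y \<partial>M)"
    by (subst nn_integral_distr) auto
  also have "\<dots> = (\<integral>\<^sup>+\<omega>. \<integral>\<^sup>+\<omega>'. f (Z \<omega>, Y \<omega>') \<partial>M \<partial>M)"
    by (intro nn_integral_cong, subst nn_integral_distr)
      (auto intro: measurable_compose[OF _ f] measurable_Pair1' simp: measurable_space[OF Z])
  finally show ?thesis .
qed

lemma nn_integral_nat_pmf:
  "(\<integral>\<^sup>+k. f k \<partial>measure_pmf p) = (\<Sum>k. ennreal (pmf p k) * f k)" for p :: "nat pmf"
  by (simp add: nn_integral_measure_pmf nn_integral_count_space_nat)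

lemma nn_integral_geometric_pmf:
  assumes "0 < p" "p \<le> 1"
  shows "(\<integral>\<^sup>+k. f k \<partial>geometric_pmf p)
    = ennreal p * f 0 + ennreal (1 - p) * (\<integral>\<^sup>+k. f (Suc k) \<partial>geometric_pmf p)"
  using assms by (subst geometric_bind_pmf_unfold) (auto simp: nn_integral_bind_pmf mult.commute)

locale random_walk = prob_space \<mu> for \<mu> :: "real measure" +
  assumes sets_eq_borel[measurable_cong]: "sets \<mu> = sets borel"
begin

text \<open>The expectation of \<open>max v (g y\<^sub>0) \<dots> (g y\<^sub>k)\<close> along \<open>k\<close> steps of the random walk started at
  \<open>y\<^sub>0 = y\<close>.\<close>

primrec walk_sup :: "(real \<Rightarrow> ennreal) \<Rightarrow> nat \<Rightarrow> ennreal \<Rightarrow> real \<Rightarrow> ennreal" where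
  "walk_sup g 0 v y = max v (g y)"
| "walk_sup g (Suc k) v y = (\<integral>\<^sup>+z. walk_sup g k (max v (g y)) (y + z) \<partial>\<mu>)"

lemma walk_sup_measurable_pair:
  assumes [measurable]: "g \<in> borel_measurable borel"
  shows "(\<lambda>x. walk_sup g k (fst x) (snd x)) \<in> borel_measurable (borel \<Otimes>\<^sub>M borel)"
proof (induction k)
  case (Suc k)
  have "(\<lambda>p. (max (fst (fst p)) (g (snd (fst p))), snd (fst p) + snd p))
      \<in> (borel \<Otimes>\<^sub>M borel) \<Otimes>\<^sub>M \<mu> \<rightarrow>\<^sub>M borel \<Otimes>\<^sub>M borel" by measurable
  from measurable_compose[OF this Suc] show ?case
    by (simp add: borel_measurable_nn_integral split_beta')
qed simp

lemma walk_sup_measurable[measurable]: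
  assumes "g \<in> borel_measurable borel" "v \<in> borel_measurable N" "y \<in> borel_measurable N"
  shows "(\<lambda>x. walk_sup g k (v x) (y x)) \<in> borel_measurable N"
  using measurable_compose[OF measurable_Pair[OF assms(2,3)] walk_sup_measurable_pair[OF assms(1)]]
  by simp

lemma walk_sup_mono: "v \<le> w \<Longrightarrow> walk_sup g k v y \<le> walk_sup g k w y"
proof (induction k arbitrary: v w y)
  case 0 then show ?case by (auto simp: max.coboundedI1)
next
  case (Suc k)
  show ?case unfolding walk_sup.simps
    by (intro nn_integral_mono Suc.IH max.mono Suc.prems order_refl)
qed

lemma walk_sup_le:
  assumes "\<And>y. g y \<le> C"
  shows "v \<le> C \<Longrightarrow> walk_sup g k v y \<le> C"
proof (induction k arbitrary: v y)
  case 0 then show ?case using assms by simp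
next
  case (Suc k)
  have "walk_sup g (Suc k) v y \<le> (\<integral>\<^sup>+z. C \<partial>\<mu>)"
    unfolding walk_sup.simps using Suc assms by (intro nn_integral_mono) auto
  then show ?case by (simp add: emeasure_space_1)
qed

definition killed_walk_sup :: "real \<Rightarrow> (real \<Rightarrow> ennreal) \<Rightarrow> real \<Rightarrow> ennreal" where
  "killed_walk_sup p g y = (\<integral>\<^sup>+k. walk_sup g k 0 y \<partial>geometric_pmf p)"

lemma killed_walk_sup_measurable[measurable]:
  assumes [measurable]: "g \<in> borel_measurable borel"
  shows "killed_walk_sup p g \<in> borel_measurable borel"
  unfolding killed_walk_sup_def[abs_def] nn_integral_nat_pmf by measurable

lemma killed_walk_sup_le:
  assumes "\<And>y. g y \<le> C"
  shows "killed_walk_sup p g y \<le> C"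
proof -
  have "killed_walk_sup p g y \<le> (\<integral>\<^sup>+k. C \<partial>geometric_pmf p)"
    unfolding killed_walk_sup_def using assms by (intro nn_integral_mono walk_sup_le) auto
  then show ?thesis by simp
qed

lemma killed_walk_sup_unfold:
  assumes "0 < p" "p \<le> 1"
  shows "killed_walk_sup p g y
    = ennreal p * g y + ennreal (1 - p) * (\<integral>\<^sup>+k. walk_sup g (Suc k) 0 y \<partial>geometric_pmf p)"
  unfolding killed_walk_sup_def by (subst nn_integral_geometric_pmf[OF assms]) simp

lemma nn_integral_killed_walk_sup:
  assumes [measurable]: "g \<in> borel_measurable borel"
  shows "(\<integral>\<^sup>+z. killed_walk_sup p g (y + z) \<partial>\<mu>)
    = (\<integral>\<^sup>+k. \<integral>\<^sup>+z. walk_sup g k 0 (y + z) \<partial>\<mu> \<partial>geometric_pmf p)"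
  unfolding killed_walk_sup_def nn_integral_nat_pmf
  by (subst nn_integral_suminf) (simp_all add: nn_integral_cmult)

lemma killed_walk_sup_excessive:
  assumes g: "g \<in> borel_measurable borel" and p: "0 < p" "p \<le> 1"
  shows "ennreal (1 - p) * (\<integral>\<^sup>+z. killed_walk_sup p g (y + z) \<partial>\<mu>) \<le> killed_walk_sup p g y"
proof -
  have "(\<integral>\<^sup>+z. killed_walk_sup p g (y + z) \<partial>\<mu>) \<le> (\<integral>\<^sup>+k. walk_sup g (Suc k) 0 y \<partial>geometric_pmf p)"
    unfolding nn_integral_killed_walk_sup[OF g] walk_sup.simps
    by (intro nn_integral_mono walk_sup_mono) simp
  then have "ennreal (1 - p) * (\<integral>\<^sup>+z. killed_walk_sup p g (y + z) \<partial>\<mu>)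
      \<le> ennreal p * g y + ennreal (1 - p) * (\<integral>\<^sup>+k. walk_sup g (Suc k) 0 y \<partial>geometric_pmf p)"
    by (intro add_increasing mult_left_mono) auto
  then show ?thesis unfolding killed_walk_sup_unfold[OF p, of g y] .
qed

lemma killed_walk_sup_harmonic:
  assumes g: "g \<in> borel_measurable borel" and p: "0 < p" "p \<le> 1" and "g y = 0"
  shows "ennreal (1 - p) * (\<integral>\<^sup>+z. killed_walk_sup p g (y + z) \<partial>\<mu>) = killed_walk_sup p g y"
  using \<open>g y = 0\<close>
  by (simp add: nn_integral_killed_walk_sup[OF g] killed_walk_sup_unfold[OF p, of g y])

end

section \<open>Filtrations and stopping times\<close>

locale usual_filtration =
  fixes M :: "'a measure" and F :: "real \<Rightarrow> 'a measure"
  assumes usual: "filtered_usual M F"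
begin

sublocale prob_space M
  using usual by (simp add: filtered_usual_def)

lemma space_F: "t \<ge> 0 \<Longrightarrow> space (F t) = space M"
  and sets_F: "t \<ge> 0 \<Longrightarrow> sets (F t) \<subseteq> sets M"
  and sets_F_mono: "0 \<le> s \<Longrightarrow> s \<le> t \<Longrightarrow> sets (F s) \<subseteq> sets (F t)"
proof -
  have "\<forall>t\<ge>0. space (F t) = space M \<and> sets (F t) \<subseteq> sets M"
    using usual unfolding filtered_usual_def by (elim conjE)
  moreover have "\<forall>s t. 0 \<le> s \<longrightarrow> s \<le> t \<longrightarrow> sets (F s) \<subseteq> sets (F t)"
    using usual unfolding filtered_usual_def by (elim conjE)
  ultimately show "t \<ge> 0 \<Longrightarrow> space (F t) = space M" "t \<ge> 0 \<Longrightarrow> sets (F t) \<subseteq> sets M"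
    "0 \<le> s \<Longrightarrow> s \<le> t \<Longrightarrow> sets (F s) \<subseteq> sets (F t)" by blast+
qed

lemma subset_null_set_in_F:
  assumes "0 \<le> t" "A \<subseteq> N" "N \<in> null_sets M"
  shows "A \<in> sets (F t)"
proof -
  have "A \<subseteq> space M" using assms sets.sets_into_space[of N M] by auto
  moreover have "\<forall>A. A \<subseteq> space M \<longrightarrow> (\<exists>N\<in>sets M. A \<subseteq> N \<and> emeasure M N = 0) \<longrightarrow> A \<in> sets (F 0)"
    using usual unfolding filtered_usual_def by (elim conjE)
  ultimately have "A \<in> sets (F 0)" using assms unfolding null_sets_def by blast
  then show ?thesis using sets_F_mono[of 0 t] assms(1) by auto
qed

lemma measurable_F_imp_measurable: "t \<ge> 0 \<Longrightarrow> f \<in> F t \<rightarrow>\<^sub>M N \<Longrightarrow> f \<in> M \<rightarrow>\<^sub>M N"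
  using space_F[of t] sets_F[of t] by (auto simp: measurable_def)

lemma measurable_F_mono: "0 \<le> s \<Longrightarrow> s \<le> t \<Longrightarrow> f \<in> F s \<rightarrow>\<^sub>M N \<Longrightarrow> f \<in> F t \<rightarrow>\<^sub>M N"
  using space_F[of t] space_F[of s] sets_F_mono[of s t] by (auto simp: measurable_def)

lemma stopping_time_sets:
  "stopping_time_ext F \<rho> \<Longrightarrow> t \<ge> 0 \<Longrightarrow> {\<omega>\<in>space M. \<rho> \<omega> \<le> ereal t} \<in> sets (F t)"
  using space_F[of t] by (auto simp: stopping_time_ext_def)

lemma stopping_time_nonneg: "stopping_time_ext F \<rho> \<Longrightarrow> \<omega> \<in> space M \<Longrightarrow> \<rho> \<omega> \<ge> 0"
  using space_F[of 0] by (auto simp: stopping_time_ext_def)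

lemma stopping_time_measurable:
  assumes "stopping_time_ext F \<rho>"
  shows "\<rho> \<in> borel_measurable M"
  unfolding borel_measurable_iff_Iic_ereal
proof
  fix a :: ereal
  consider (negative) "a < 0" | (infinite) "a = \<infinity>" | (finite) t where "t \<ge> 0" "a = ereal t"
    by (cases a; cases "0 \<le> a") (auto simp: not_le)
  then show "\<rho> -` {..a} \<inter> space M \<in> sets M"
  proof cases
    case negative
    then have "\<rho> -` {..a} \<inter> space M = {}"
      using stopping_time_nonneg[OF assms] by fastforce
    then show ?thesis by (simp only: sets.empty_sets)
  next
    case infinite
    then have "\<rho> -` {..a} \<inter> space M = space M" by auto
    then show ?thesis by simp
  next
    case finite
    then have "\<rho> -` {..a} \<inter> space M = {\<omega>\<in>space M. \<rho> \<omega> \<le> ereal t}" by auto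
    then show ?thesis using stopping_time_sets[OF assms finite(1)] sets_F[OF finite(1)] by auto
  qed
qed

lemma stopping_time_min:
  assumes "stopping_time_ext F \<rho>" "stopping_time_ext F \<sigma>"
  shows "stopping_time_ext F (\<lambda>\<omega>. min (\<rho> \<omega>) (\<sigma> \<omega>))"
  unfolding stopping_time_ext_def
proof (intro conjI allI impI ballI)
  fix t :: real assume "t \<ge> 0"
  then have "{\<omega>\<in>space (F t). \<rho> \<omega> \<le> ereal t} \<union> {\<omega>\<in>space (F t). \<sigma> \<omega> \<le> ereal t} \<in> sets (F t)"
    using assms unfolding stopping_time_ext_def by (intro sets.Un) auto
  also have "{\<omega>\<in>space (F t). \<rho> \<omega> \<le> ereal t} \<union> {\<omega>\<in>space (F t). \<sigma> \<omega> \<le> ereal t}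
      = {\<omega>\<in>space (F t). min (\<rho> \<omega>) (\<sigma> \<omega>) \<le> ereal t}" by (auto simp: min_le_iff_disj)
  finally show "{\<omega>\<in>space (F t). min (\<rho> \<omega>) (\<sigma> \<omega>) \<le> ereal t} \<in> sets (F t)" .
qed (use assms in \<open>auto simp: stopping_time_ext_def\<close>)

end

section \<open>Levy processes\<close>

locale levy =
  fixes M :: "'a measure" and F :: "real \<Rightarrow> 'a measure" and X :: "real \<Rightarrow> 'a \<Rightarrow> real"
  assumes levy: "levy_process M F X"

sublocale levy \<subseteq> usual_filtration M F
  using levy by unfold_locales (simp add: levy_process_def)

context levy
begin

lemma X_0: "\<omega> \<in> space M \<Longrightarrow> X 0 \<omega> = 0"
  and X_adapted: "t \<ge> 0 \<Longrightarrow> X t \<in> borel_measurable (F t)"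
  and cadlag_X: "\<omega> \<in> space M \<Longrightarrow> cadlag (\<lambda>t. X t \<omega>)"
  and indep_increment: "0 \<le> s \<Longrightarrow> 0 \<le> t \<Longrightarrow> indep_set (sets (F t))
        {(\<lambda>\<omega>. X (t + s) \<omega> - X t \<omega>) -` B \<inter> space M | B. B \<in> sets borel}"
  and distr_increment: "0 \<le> s \<Longrightarrow> 0 \<le> t \<Longrightarrow>
        distr M borel (\<lambda>\<omega>. X (t + s) \<omega> - X t \<omega>) = distr M borel (X s)"
  using levy unfolding levy_process_def cadlag_def by (elim conjE; blast)+

lemma X_measurable_F: "0 \<le> s \<Longrightarrow> s \<le> t \<Longrightarrow> X s \<in> borel_measurable (F t)"
  by (rule measurable_F_mono[OF _ _ X_adapted])

lemma X_measurable[measurable]: "t \<ge> 0 \<Longrightarrow> X t \<in> borel_measurable M"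
  by (rule measurable_F_imp_measurable[OF _ X_adapted])

lemma X_random_time_measurable:
  assumes [measurable]: "T \<in> borel_measurable M" and T: "\<And>\<omega>. \<omega> \<in> space M \<Longrightarrow> T \<omega> \<ge> 0"
  shows "(\<lambda>\<omega>. X (T \<omega>) \<omega>) \<in> borel_measurable M"
proof (rule borel_measurable_LIMSEQ_real)
  define h where "h n = 1 / real (Suc n)" for n
  have h: "h n > 0" "h \<longlonglongrightarrow> 0" for n
    unfolding h_def by (simp, rule LIMSEQ_Suc[OF lim_1_over_n])
  show "(\<lambda>n. X (real (nat \<lceil>T \<omega> / h n\<rceil>) * h n) \<omega>) \<longlonglongrightarrow> X (T \<omega>) \<omega>" if "\<omega> \<in> space M" for \<omega>
    by (rule cadlag_grid_ceiling_tendsto[OF cadlag_X[OF that] T[OF that] h])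
  show "(\<lambda>\<omega>. X (real (nat \<lceil>T \<omega> / h n\<rceil>) * h n) \<omega>) \<in> borel_measurable M" for n
  proof (rule measurable_compose_countable[where f="\<lambda>k \<omega>. X (real k * h n) \<omega>"])
    show "X (real k * h n) \<in> borel_measurable M" for k using h(1)[of n] by (intro X_measurable) simp
  qed measurable
qed

definition running_sup :: "real \<Rightarrow> 'a \<Rightarrow> real" where
  "running_sup t \<omega> = (SUP s\<in>{0..t}. X s \<omega>)"

lemma X_le_running_sup: "\<omega> \<in> space M \<Longrightarrow> 0 \<le> s \<Longrightarrow> s \<le> t \<Longrightarrow> X s \<omega> \<le> running_sup t \<omega>"
  unfolding running_sup_def by (rule cadlag_le_Sup[OF cadlag_X])

lemma running_sup_mono: "\<omega> \<in> space M \<Longrightarrow> 0 \<le> s \<Longrightarrow> s \<le> t \<Longrightarrow> running_sup s \<omega> \<le> running_sup t \<omega>"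
  unfolding running_sup_def by (intro cSUP_subset_mono cadlag_bdd_above cadlag_X) auto

lemma running_sup_measurable:
  assumes N: "space N = space M" and T: "\<And>\<omega>. \<omega> \<in> space M \<Longrightarrow> T \<omega> \<ge> 0"
    and X: "\<And>q. 0 \<le> q \<Longrightarrow> q \<le> 1 \<Longrightarrow> (\<lambda>\<omega>. X (q * T \<omega>) \<omega>) \<in> borel_measurable N"
  shows "(\<lambda>\<omega>. running_sup (T \<omega>) \<omega>) \<in> borel_measurable N"
  unfolding borel_measurable_iff_greater
proof
  fix c
  have "c < running_sup (T \<omega>) \<omega> \<longleftrightarrow> (\<exists>q\<in>\<rat> \<inter> {0..1}. c < X (q * T \<omega>) \<omega>)" if "\<omega> \<in> space M" for \<omega>
    unfolding running_sup_def by (rule less_cadlag_Sup_iff_Rats[OF cadlag_X[OF that] T[OF that]])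
  then have "{\<omega>\<in>space N. c < running_sup (T \<omega>) \<omega>}
      = (\<Union>q\<in>\<rat> \<inter> {0..1}. {\<omega>\<in>space N. c < X (q * T \<omega>) \<omega>})"
    unfolding N by blast
  moreover have "countable (\<rat> \<inter> {0..1 :: real})" by (simp add: countable_rat countable_Int1)
  moreover have "{\<omega>\<in>space N. c < X (q * T \<omega>) \<omega>} \<in> sets N" if "q \<in> \<rat> \<inter> {0..1}" for q
    using X[of q] that unfolding borel_measurable_iff_greater by simp
  ultimately show "{\<omega>\<in>space N. c < running_sup (T \<omega>) \<omega>} \<in> sets N"
    using sets.countable_UN''[of "\<rat> \<inter> {0..1}" "\<lambda>q. {\<omega>\<in>space N. c < X (q * T \<omega>) \<omega>}" N] by simp
qed

definition step_law :: "real \<Rightarrow> real measure" where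
  "step_law h = distr M borel (X h)"

lemma random_walk_step_law: "h \<ge> 0 \<Longrightarrow> random_walk (step_law h)"
  unfolding step_law_def random_walk_def random_walk_axioms_def by (auto intro!: prob_space_distr)

lemma nn_integral_markov:
  assumes t: "0 \<le> t" and h: "0 \<le> h" and Z: "Z \<in> F t \<rightarrow>\<^sub>M N"
    and f[measurable]: "f \<in> borel_measurable (N \<Otimes>\<^sub>M borel)"
  shows "(\<integral>\<^sup>+\<omega>. f (Z \<omega>, X (t + h) \<omega> - X t \<omega>) \<partial>M) = (\<integral>\<^sup>+\<omega>. \<integral>\<^sup>+z. f (Z \<omega>, z) \<partial>step_law h \<partial>M)"
proof -
  have [measurable]: "Z \<in> M \<rightarrow>\<^sub>M N" by (rule measurable_F_imp_measurable[OF t Z])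
  have "(\<integral>\<^sup>+\<omega>. f (Z \<omega>, X (t + h) \<omega> - X t \<omega>) \<partial>M)
      = (\<integral>\<^sup>+\<omega>. \<integral>\<^sup>+\<omega>'. f (Z \<omega>, X (t + h) \<omega>' - X t \<omega>') \<partial>M \<partial>M)"
    using t h measurable_sets[OF Z] space_F[OF t]
    by (intro indep_set_nn_integral[OF indep_increment[OF h t], where N=N and K=borel]) auto
  also have "\<dots> = (\<integral>\<^sup>+\<omega>. \<integral>\<^sup>+z. f (Z \<omega>, z) \<partial>distr M borel (\<lambda>\<omega>. X (t + h) \<omega> - X t \<omega>) \<partial>M)"
    using t h measurable_space[OF Z] space_F[OF t]
    by (intro nn_integral_cong, subst nn_integral_distr)
      (auto intro: measurable_compose[OF _ f] measurable_Pair1')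
  finally show ?thesis unfolding distr_increment[OF h t] step_law_def .
qed

subsection \<open>Suprema along a time grid\<close>

definition grid_sup :: "(real \<Rightarrow> ennreal) \<Rightarrow> real \<Rightarrow> real \<Rightarrow> nat \<Rightarrow> 'a \<Rightarrow> ennreal" where
  "grid_sup g h y i \<omega> = (SUP j\<in>{..<i}. g (y + X (real j * h) \<omega>))"

lemma grid_sup_0: "grid_sup g h y 0 \<omega> = 0"
  by (simp add: grid_sup_def bot_ennreal)

lemma grid_sup_Suc: "grid_sup g h y (Suc i) \<omega> = max (grid_sup g h y i \<omega>) (g (y + X (real i * h) \<omega>))"
  by (simp add: grid_sup_def lessThan_Suc sup_commute flip: sup_max)

lemma grid_sup_measurable:
  assumes g: "g \<in> borel_measurable borel"
    and X: "\<And>j. j < i \<Longrightarrow> X (real j * h) \<in> borel_measurable N"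
  shows "grid_sup g h y i \<in> borel_measurable N"
  unfolding grid_sup_def[abs_def]
proof (rule borel_measurable_SUP)
  fix j assume "j \<in> {..<i}"
  then have [measurable]: "X (real j * h) \<in> borel_measurable N" using X by simp
  show "(\<lambda>\<omega>. g (y + X (real j * h) \<omega>)) \<in> borel_measurable N" using g by measurable
qed simp

lemma grid_sup_eq_Max:
  fixes g :: "real \<Rightarrow> real"
  assumes "mono g"
  shows "grid_sup (\<lambda>z. ennreal (g z)) h y (Suc n) \<omega>
    = ennreal (g (y + (MAX j\<in>{..n}. X (real j * h) \<omega>)))"
proof -
  have "mono (\<lambda>z. ennreal (g (y + z)))"
    using assms by (auto simp: mono_def intro: ennreal_leI)
  then have "ennreal (g (y + (MAX j\<in>{..n}. X (real j * h) \<omega>)))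
      = Max ((\<lambda>z. ennreal (g (y + z))) ` (\<lambda>j. X (real j * h) \<omega>) ` {..n})"
    by (rule mono_Max_commute) auto
  then show ?thesis
    by (simp add: grid_sup_def image_image lessThan_Suc_atMost cSup_eq_Max)
qed

lemma nn_integral_walk_sup_grid_sup:
  assumes g[measurable]: "g \<in> borel_measurable borel" and h: "h \<ge> 0"
  shows "(\<integral>\<^sup>+\<omega>. random_walk.walk_sup (step_law h) g k (grid_sup g h y i \<omega>) (y + X (real i * h) \<omega>) \<partial>M)
       = (\<integral>\<^sup>+\<omega>. grid_sup g h y (Suc (i + k)) \<omega> \<partial>M)"
proof -
  interpret walk: random_walk "step_law h" using h by (rule random_walk_step_law)
  show ?thesis
  proof (induction k arbitrary: i)
    case 0
    show ?case by (simp add: grid_sup_Suc)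
  next
    case (Suc k)
    let ?t = "real i * h" and ?f = "\<lambda>p. walk.walk_sup g k (fst (fst p)) (snd (fst p) + snd p)"
    let ?Z = "\<lambda>\<omega>. (grid_sup g h y (Suc i) \<omega>, y + X ?t \<omega>)"
    have t: "?t \<ge> 0" "real (Suc i) * h = ?t + h" using h by (auto simp: algebra_simps)
    have [measurable]: "grid_sup g h y (Suc i) \<in> borel_measurable (F ?t)" "X ?t \<in> borel_measurable (F ?t)"
      using h by (auto intro!: grid_sup_measurable X_measurable_F mult_right_mono)
    have Z: "?Z \<in> F ?t \<rightarrow>\<^sub>M borel \<Otimes>\<^sub>M borel" by measurable
    have "(\<integral>\<^sup>+\<omega>. walk.walk_sup g (Suc k) (grid_sup g h y i \<omega>) (y + X ?t \<omega>) \<partial>M)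
        = (\<integral>\<^sup>+\<omega>. \<integral>\<^sup>+z. ?f (?Z \<omega>, z) \<partial>step_law h \<partial>M)"
      by (simp add: grid_sup_Suc)
    also have "\<dots> = (\<integral>\<^sup>+\<omega>. ?f (?Z \<omega>, X (?t + h) \<omega> - X ?t \<omega>) \<partial>M)"
      by (intro nn_integral_markov[OF t(1) h Z, symmetric]) measurable
    also have "\<dots>
        = (\<integral>\<^sup>+\<omega>. walk.walk_sup g k (grid_sup g h y (Suc i) \<omega>) (y + X (real (Suc i) * h) \<omega>) \<partial>M)"
      unfolding t(2) by simp
    also have "\<dots> = (\<integral>\<^sup>+\<omega>. grid_sup g h y (Suc (Suc i + k)) \<omega> \<partial>M)" by (rule Suc.IH)
    finally show ?case by simp
  qed
qed

lemma nn_integral_grid_sup: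
  assumes "g \<in> borel_measurable borel" "h \<ge> 0"
  shows "(\<integral>\<^sup>+\<omega>. grid_sup g h y (Suc k) \<omega> \<partial>M) = random_walk.walk_sup (step_law h) g k 0 y"
proof -
  have "random_walk.walk_sup (step_law h) g k 0 y
      = (\<integral>\<^sup>+\<omega>. random_walk.walk_sup (step_law h) g k (grid_sup g h y 0 \<omega>) (y + X (real 0 * h) \<omega>) \<partial>M)"
    by (simp add: grid_sup_0 X_0 emeasure_space_1 cong: nn_integral_cong)
  then show ?thesis using nn_integral_walk_sup_grid_sup[OF assms, of k y 0] by simp
qed

end

section \<open>Levy processes killed at an exponential time\<close>

locale killed_levy = levy M F X
  for M :: "'a measure" and F X +
  fixes er :: "'a \<Rightarrow> real" and r :: real
  assumes r_pos: "r > 0"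
    and er_exp: "distributed M lborel er (exponential_density r)"
    and er_indep: "indep_set {er -` B \<inter> space M | B. B \<in> sets borel}
        (sigma_sets (space M) {X t -` B \<inter> space M | t B. 0 \<le> t \<and> B \<in> sets borel})"
begin

lemma er_measurable[measurable]: "er \<in> borel_measurable M"
  using er_exp by (auto simp: distributed_def)

lemma AE_er_pos: "AE \<omega> in M. er \<omega> > 0"
proof -
  have "prob {\<omega>\<in>space M. 0 < er \<omega>} = 1"
    using exponential_distributedD_gt[OF er_exp order_refl r_pos] by simp
  from AE_prob_1[OF this] show ?thesis by eventually_elim simp
qed

lemma prob_er_Ioc:
  assumes "0 \<le> s" "s \<le> t"
  shows "prob {\<omega>\<in>space M. s < er \<omega> \<and> er \<omega> \<le> t} = exp (- r * s) - exp (- r * t)"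
proof -
  have "{\<omega>\<in>space M. s < er \<omega> \<and> er \<omega> \<le> t} = {\<omega>\<in>space M. s < er \<omega>} - {\<omega>\<in>space M. t < er \<omega>}"
    by auto
  also have "prob \<dots> = prob {\<omega>\<in>space M. s < er \<omega>} - prob {\<omega>\<in>space M. t < er \<omega>}"
    using assms by (intro finite_measure_Diff) auto
  finally show ?thesis
    using exponential_distributedD_gt[OF er_exp _ r_pos] assms by (simp add: mult.commute)
qed

definition step_killing_prob :: "real \<Rightarrow> real" where
  "step_killing_prob h = 1 - exp (- r * h)"

lemma step_killing_prob: "h > 0 \<Longrightarrow> 0 < step_killing_prob h" "step_killing_prob h \<le> 1"
  using r_pos by (auto simp: step_killing_prob_def)

lemma distr_killing_step:
  assumes h: "h > 0"
  shows "distr M (count_space UNIV) (\<lambda>\<omega>. nat \<lceil>er \<omega> / h\<rceil> - 1) = geometric_pmf (step_killing_prob h)"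
proof (rule measure_eqI_countable[of _ UNIV])
  fix k
  have "emeasure (distr M (count_space UNIV) (\<lambda>\<omega>. nat \<lceil>er \<omega> / h\<rceil> - 1)) {k}
      = emeasure M {\<omega>\<in>space M. nat \<lceil>er \<omega> / h\<rceil> - 1 = k}"
    by (subst emeasure_distr) (auto intro!: arg_cong[where f="emeasure M"])
  also have "\<dots> = emeasure M {\<omega>\<in>space M. real k * h < er \<omega> \<and> er \<omega> \<le> real (Suc k) * h}"
  proof (rule emeasure_eq_AE)
    show "AE \<omega> in M. \<omega> \<in> {\<omega>\<in>space M. nat \<lceil>er \<omega> / h\<rceil> - 1 = k}
        \<longleftrightarrow> \<omega> \<in> {\<omega>\<in>space M. real k * h < er \<omega> \<and> er \<omega> \<le> real (Suc k) * h}"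
      using AE_er_pos
    proof eventually_elim
      case (elim \<omega>)
      then have "0 < er \<omega> / h" using h by simp
      then have "nat \<lceil>er \<omega> / h\<rceil> - 1 = k \<longleftrightarrow> real k < er \<omega> / h \<and> er \<omega> / h \<le> real (Suc k)" by linarith
      also have "\<dots> \<longleftrightarrow> real k * h < er \<omega> \<and> er \<omega> \<le> real (Suc k) * h" using h by (simp add: field_simps)
      finally show ?case by simp
    qed
  qed measurable
  also have "\<dots> = ennreal (exp (- r * (real k * h)) - exp (- r * (real (Suc k) * h)))"
    unfolding emeasure_eq_measure using h by (subst prob_er_Ioc) (auto intro: mult_right_mono)
  also have "exp (- r * (real k * h)) - exp (- r * (real (Suc k) * h))
      = (1 - step_killing_prob h) ^ k * step_killing_prob h"
    by (simp add: step_killing_prob_def exp_of_nat_mult[symmetric] algebra_simps exp_add[symmetric] exp_diff)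
  finally show "emeasure (distr M (count_space UNIV) (\<lambda>\<omega>. nat \<lceil>er \<omega> / h\<rceil> - 1)) {k}
      = emeasure (geometric_pmf (step_killing_prob h)) {k}"
    using step_killing_prob h by (simp add: emeasure_pmf_single)
qed auto

abbreviation path_algebra :: "'a measure" where
  "path_algebra \<equiv> sigma (space M) {X t -` B \<inter> space M | t B. 0 \<le> t \<and> B \<in> sets borel}"

lemma sets_path_algebra:
  "sets path_algebra = sigma_sets (space M) {X t -` B \<inter> space M | t B. 0 \<le> t \<and> B \<in> sets borel}"
  by (intro sets_measure_of) auto

lemma sets_path_algebra_subset: "sets path_algebra \<subseteq> events"
  unfolding sets_path_algebra by (intro sets.sigma_sets_subset) auto

lemma X_measurable_path_algebra: "t \<ge> 0 \<Longrightarrow> X t \<in> borel_measurable path_algebra"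
  by (intro measurableI)
    (auto intro!: sigma_sets.Basic simp: sets_measure_of_conv space_measure_of_conv)

lemma nn_integral_killing_step:
  assumes h: "h > 0" and f: "\<And>k. f k \<in> borel_measurable path_algebra"
  shows "(\<integral>\<^sup>+\<omega>. f (nat \<lceil>er \<omega> / h\<rceil>) \<omega> \<partial>M)
    = (\<integral>\<^sup>+k. \<integral>\<^sup>+\<omega>. f (Suc k) \<omega> \<partial>M \<partial>geometric_pmf (step_killing_prob h))"
proof -
  define N where "N \<omega> = nat \<lceil>er \<omega> / h\<rceil> - 1" for \<omega>
  have N_measurable[measurable]: "N \<in> M \<rightarrow>\<^sub>M count_space UNIV" unfolding N_def by measurable
  have "AE \<omega> in M. f (nat \<lceil>er \<omega> / h\<rceil>) \<omega> = f (Suc (N \<omega>)) \<omega>"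
    using AE_er_pos
  proof eventually_elim
    case (elim \<omega>)
    then have "0 < er \<omega> / h" using h by simp
    then show ?case by (simp add: N_def)
  qed
  then have "(\<integral>\<^sup>+\<omega>. f (nat \<lceil>er \<omega> / h\<rceil>) \<omega> \<partial>M) = (\<integral>\<^sup>+\<omega>. f (Suc (N \<omega>)) \<omega> \<partial>M)"
    by (rule nn_integral_cong_AE)
  also have "\<dots> = (\<integral>\<^sup>+\<omega>. \<integral>\<^sup>+\<omega>'. f (Suc (N \<omega>)) \<omega>' \<partial>M \<partial>M)"
  proof -
    have id: "(\<lambda>\<omega>. \<omega>) \<in> M \<rightarrow>\<^sub>M path_algebra"
      using sets_path_algebra_subset by (intro measurableI) (auto simp: space_measure_of_conv)
    have N_er: "N -` A \<inter> space M \<in> {er -` B \<inter> space M | B. B \<in> sets borel}" for A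
    proof -
      have "(\<lambda>x :: real. nat \<lceil>x / h\<rceil> - 1) \<in> borel \<rightarrow>\<^sub>M count_space UNIV" by measurable
      then have "(\<lambda>x. nat \<lceil>x / h\<rceil> - 1) -` A \<in> sets (borel :: real measure)"
        using measurable_sets[of "\<lambda>x. nat \<lceil>x / h\<rceil> - 1" borel "count_space UNIV" A] by simp
      moreover have "N -` A = er -` ((\<lambda>x. nat \<lceil>x / h\<rceil> - 1) -` A)" by (auto simp: N_def)
      ultimately show ?thesis by auto
    qed
    have joint: "(\<lambda>p. f (Suc (fst p)) (snd p)) \<in> borel_measurable (count_space UNIV \<Otimes>\<^sub>M path_algebra)"
      using f by (intro measurable_pair_measure_countable1) auto
    have "(\<lambda>\<omega>. \<omega>) -` B \<inter> space M
        \<in> sigma_sets (space M) {X t -` B \<inter> space M | t B. 0 \<le> t \<and> B \<in> sets borel}"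
      if "B \<in> sets path_algebra" for B
      using that sets_path_algebra_subset sets.sets_into_space[of B M]
      by (auto simp: sets_path_algebra Int_absorb2)
    from indep_set_nn_integral[OF er_indep N_measurable id N_er this joint] show ?thesis by simp
  qed
  also have "\<dots> = (\<integral>\<^sup>+k. \<integral>\<^sup>+\<omega>. f (Suc k) \<omega> \<partial>M \<partial>distr M (count_space UNIV) N)"
    by (subst nn_integral_distr) auto
  finally show ?thesis unfolding N_def distr_killing_step[OF h] .
qed

lemma nn_integral_grid_sup_killed:
  assumes g: "g \<in> borel_measurable borel" and h: "h > 0"
  shows "(\<integral>\<^sup>+\<omega>. grid_sup g h y (Suc (nat \<lceil>er \<omega> / h\<rceil>)) \<omega> \<partial>M)
    = (\<integral>\<^sup>+k. random_walk.walk_sup (step_law h) g (Suc k) 0 y \<partial>geometric_pmf (step_killing_prob h))"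
  using g h nn_integral_killing_step[OF h, of "\<lambda>k. grid_sup g h y (Suc k)"]
  by (simp add: nn_integral_grid_sup grid_sup_measurable X_measurable_path_algebra)

text \<open>Taking the maximum with \<open>0\<close> only affects the null set on which \<open>er\<close> is negative.\<close>

definition killed_sup :: "'a \<Rightarrow> real" where
  "killed_sup \<omega> = running_sup (max 0 (er \<omega>)) \<omega>"

lemma killed_sup_nonneg: "\<omega> \<in> space M \<Longrightarrow> killed_sup \<omega> \<ge> 0"
  using X_le_running_sup[of \<omega> 0 "max 0 (er \<omega>)"] by (simp add: killed_sup_def X_0)

lemma killed_sup_measurable[measurable]: "killed_sup \<in> borel_measurable M"
  unfolding killed_sup_def[abs_def]
  by (intro running_sup_measurable X_random_time_measurable) auto

lemma grid_sup_tendsto_killed_sup: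
  fixes g :: "real \<Rightarrow> real"
  assumes \<omega>: "\<omega> \<in> space M" "er \<omega> > 0" and h: "\<And>n. h n > 0" "h \<longlonglongrightarrow> 0"
    and g: "mono g" "continuous_on UNIV g" and y: "y \<longlonglongrightarrow> z"
  shows "(\<lambda>n. grid_sup (\<lambda>z. ennreal (g z)) (h n) (y n) (Suc (nat \<lceil>er \<omega> / h n\<rceil>)) \<omega>)
    \<longlonglongrightarrow> ennreal (g (z + killed_sup \<omega>))"
proof -
  have "(\<lambda>n. MAX j\<in>{..nat \<lceil>er \<omega> / h n\<rceil>}. X (real j * h n) \<omega>) \<longlonglongrightarrow> killed_sup \<omega>"
    unfolding killed_sup_def running_sup_def
    using \<omega> cadlag_grid_Max_tendsto[OF cadlag_X[OF \<omega>(1)] _ h, of "er \<omega>"] by (simp add: max_def)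
  then show ?thesis
    unfolding grid_sup_eq_Max[OF g(1)]
    by (intro tendsto_ennrealI continuous_on_tendsto_compose[OF g(2)] tendsto_add y) auto
qed

definition grid_value :: "(real \<Rightarrow> ennreal) \<Rightarrow> real \<Rightarrow> real \<Rightarrow> ennreal" where
  "grid_value g h = random_walk.killed_walk_sup (step_law h) (step_killing_prob h) g"

definition sup_value :: "(real \<Rightarrow> real) \<Rightarrow> real \<Rightarrow> ennreal" where
  "sup_value g y = (\<integral>\<^sup>+\<omega>. ennreal (g (y + killed_sup \<omega>)) \<partial>M)"

lemma grid_value_measurable[measurable]:
  "g \<in> borel_measurable borel \<Longrightarrow> h \<ge> 0 \<Longrightarrow> grid_value g h \<in> borel_measurable borel"
  unfolding grid_value_def by (rule random_walk.killed_walk_sup_measurable[OF random_walk_step_law])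

lemma grid_value_le: "(\<And>y. g y \<le> C) \<Longrightarrow> h \<ge> 0 \<Longrightarrow> grid_value g h y \<le> C"
  unfolding grid_value_def by (rule random_walk.killed_walk_sup_le[OF random_walk_step_law])

lemma sup_value_measurable[measurable]:
  assumes [measurable]: "g \<in> borel_measurable borel"
  shows "sup_value g \<in> borel_measurable borel"
  unfolding sup_value_def[abs_def] by measurable

lemma sup_value_le:
  assumes "\<And>y. g y \<le> C"
  shows "sup_value g y \<le> ennreal C"
proof -
  have "sup_value g y \<le> (\<integral>\<^sup>+\<omega>. ennreal C \<partial>M)"
    unfolding sup_value_def using assms by (intro nn_integral_mono ennreal_leI)
  then show ?thesis by (simp add: emeasure_space_1)
qed

text \<open>The grid value stops the walk after \<open>\<lfloor>er / h\<rfloor>\<close> steps, which makes its one-step relation exact;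
  the supremum along the path needs \<open>\<lceil>er / h\<rceil>\<close> steps. The two differ by a term of order \<open>h\<close>.\<close>

lemma grid_value_eq:
  assumes "g \<in> borel_measurable borel" "h > 0"
  shows "grid_value g h y
    = ennreal (step_killing_prob h) * g y + ennreal (1 - step_killing_prob h) *
      (\<integral>\<^sup>+\<omega>. grid_sup g h y (Suc (nat \<lceil>er \<omega> / h\<rceil>)) \<omega> \<partial>M)"
  unfolding nn_integral_grid_sup_killed[OF assms] grid_value_def using assms(2)
  by (intro random_walk.killed_walk_sup_unfold random_walk_step_law step_killing_prob) simp

lemma nn_integral_grid_sup_tendsto_sup_value:
  fixes g :: "real \<Rightarrow> real"
  assumes h: "\<And>n. h n > 0" "h \<longlonglongrightarrow> 0"
    and g: "mono g" "continuous_on UNIV g" "\<And>y. g y \<le> C" and y: "y \<longlonglongrightarrow> z"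
  shows "(\<lambda>n. \<integral>\<^sup>+\<omega>. grid_sup (\<lambda>z. ennreal (g z)) (h n) (y n) (Suc (nat \<lceil>er \<omega> / h n\<rceil>)) \<omega> \<partial>M)
    \<longlonglongrightarrow> sup_value g z"
  unfolding sup_value_def
proof (rule nn_integral_dominated_convergence[where w="\<lambda>_. ennreal C"])
  let ?g = "\<lambda>z. ennreal (g z)"
  have [measurable]: "g \<in> borel_measurable borel"
    using g(2) by (rule borel_measurable_continuous_onI)
  show "(\<lambda>\<omega>. grid_sup ?g (h n) (y n) (Suc (nat \<lceil>er \<omega> / h n\<rceil>)) \<omega>) \<in> borel_measurable M" for n
  proof (rule measurable_compose_countable[where f="\<lambda>i \<omega>. grid_sup ?g (h n) (y n) (Suc i) \<omega>"])
    show "grid_sup ?g (h n) (y n) (Suc i) \<in> borel_measurable M" for i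
      using h(1)[of n] by (intro grid_sup_measurable X_measurable) auto
  qed measurable
  show "(\<lambda>\<omega>. ?g (z + killed_sup \<omega>)) \<in> borel_measurable M" by measurable
  show "AE \<omega> in M. grid_sup ?g (h n) (y n) (Suc (nat \<lceil>er \<omega> / h n\<rceil>)) \<omega> \<le> ennreal C" for n
    unfolding grid_sup_def using g(3) by (intro AE_I2 SUP_least ennreal_leI)
  show "AE \<omega> in M. (\<lambda>n. grid_sup ?g (h n) (y n) (Suc (nat \<lceil>er \<omega> / h n\<rceil>)) \<omega>)
      \<longlonglongrightarrow> ?g (z + killed_sup \<omega>)"
    using AE_er_pos AE_space
    by eventually_elim (rule grid_sup_tendsto_killed_sup[OF _ _ h g(1,2) y])
qed (simp_all add: emeasure_space_1)

lemma grid_value_tendsto_sup_value: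
  fixes g :: "real \<Rightarrow> real"
  assumes h: "\<And>n. h n > 0" "h \<longlonglongrightarrow> 0"
    and g: "mono g" "continuous_on UNIV g" "\<And>y. g y \<le> C" and y: "y \<longlonglongrightarrow> z"
  shows "(\<lambda>n. grid_value (\<lambda>z. ennreal (g z)) (h n) (y n)) \<longlonglongrightarrow> sup_value g z"
proof -
  let ?g = "\<lambda>z. ennreal (g z)"
  have [measurable]: "g \<in> borel_measurable borel"
    using g(2) by (rule borel_measurable_continuous_onI)
  have "sup_value g z < \<top>"
    using sup_value_le[of g C z] g(3) by (auto intro: le_less_trans)
  moreover have "(\<lambda>n. exp (- r * h n)) \<longlonglongrightarrow> 1"
    using tendsto_exp[OF tendsto_mult[OF tendsto_const h(2), of "- r"]] by simp
  then have "(\<lambda>n. step_killing_prob (h n)) \<longlonglongrightarrow> 0"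
    unfolding step_killing_prob_def using tendsto_diff[OF tendsto_const, of _ 1 sequentially 1]
    by fastforce
  moreover have "(\<lambda>n. g (y n)) \<longlonglongrightarrow> g z"
    using y by (intro continuous_on_tendsto_compose[OF g(2)]) auto
  ultimately have "(\<lambda>n. ennreal (step_killing_prob (h n)) * ?g (y n) + ennreal (1 - step_killing_prob (h n)) *
        (\<integral>\<^sup>+\<omega>. grid_sup ?g (h n) (y n) (Suc (nat \<lceil>er \<omega> / h n\<rceil>)) \<omega> \<partial>M))
      \<longlonglongrightarrow> ennreal 0 * ?g z + ennreal (1 - 0) * sup_value g z"
    by (intro tendsto_add tendsto_mult_ennreal tendsto_ennrealI tendsto_diff tendsto_const
        nn_integral_grid_sup_tendsto_sup_value[OF h g y]) auto
  then show ?thesis using h(1) by (simp add: grid_value_eq)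
qed

end

section \<open>Optional sampling\<close>

definition grid_ceiling :: "real \<Rightarrow> ereal \<Rightarrow> ereal" where
  "grid_ceiling h t = (if t = \<infinity> then \<infinity> else ereal (real (nat \<lceil>real_of_ereal t / h\<rceil>) * h))"

lemma grid_ceiling_nonneg: "h \<ge> 0 \<Longrightarrow> grid_ceiling h t \<ge> 0"
  by (simp add: grid_ceiling_def)

lemma grid_ceiling_measurable[measurable]:
  assumes [measurable]: "\<rho> \<in> borel_measurable M"
  shows "(\<lambda>\<omega>. grid_ceiling h (\<rho> \<omega>)) \<in> borel_measurable M"
  unfolding grid_ceiling_def by measurable

lemma grid_ceiling_grid_point: "h > 0 \<Longrightarrow> grid_ceiling h (ereal (real k * h)) = ereal (real k * h)"
  by (simp add: grid_ceiling_def)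

lemma grid_ceiling_eq_Suc:
  assumes "h > 0" "ereal (real k * h) < t" "t \<le> ereal (real (Suc k) * h)"
  shows "grid_ceiling h t = ereal (real (Suc k) * h)"
proof -
  obtain s where s: "t = ereal s" using assms by (cases t) auto
  then have "real k < s / h" "s / h \<le> real (Suc k)"
    using assms by (simp_all add: pos_less_divide_eq pos_divide_le_eq)
  then have "\<lceil>s / h\<rceil> = int (Suc k)" by (intro ceiling_unique) auto
  then show ?thesis by (simp add: grid_ceiling_def s)
qed

context killed_levy
begin

definition disc_value :: "(real \<Rightarrow> ennreal) \<Rightarrow> real \<Rightarrow> ('a \<Rightarrow> ereal) \<Rightarrow> 'a \<Rightarrow> ennreal" where
  "disc_value f x \<rho> \<omega> = (if \<rho> \<omega> = \<infinity> then 0 else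
     ennreal (exp (- r * real_of_ereal (\<rho> \<omega>))) * f (x + X (real_of_ereal (\<rho> \<omega>)) \<omega>))"

lemma disc_value_measurable:
  assumes [measurable]: "f \<in> borel_measurable borel" "\<rho> \<in> borel_measurable M"
    and "\<And>\<omega>. \<omega> \<in> space M \<Longrightarrow> \<rho> \<omega> \<ge> 0"
  shows "disc_value f x \<rho> \<in> borel_measurable M"
proof -
  have [measurable]: "(\<lambda>\<omega>. X (real_of_ereal (\<rho> \<omega>)) \<omega>) \<in> borel_measurable M"
    using assms(3) by (intro X_random_time_measurable) (auto simp: real_of_ereal_pos)
  show ?thesis unfolding disc_value_def[abs_def] by measurable
qed

lemma disc_value_le:
  assumes f: "\<And>y. f y \<le> C" and "\<rho> \<omega> \<ge> 0"
  shows "disc_value f x \<rho> \<omega> \<le> C"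
proof -
  have "exp (- r * real_of_ereal (\<rho> \<omega>)) \<le> 1"
    using r_pos assms(2) by (simp add: real_of_ereal_pos)
  then have "ennreal (exp (- r * real_of_ereal (\<rho> \<omega>))) * f (x + X (real_of_ereal (\<rho> \<omega>)) \<omega>)
      \<le> ennreal 1 * C"
    using f by (intro mult_mono ennreal_leI) auto
  then show ?thesis by (simp add: disc_value_def)
qed

definition vanishes_before :: "(real \<Rightarrow> 'b :: zero) \<Rightarrow> real \<Rightarrow> ('a \<Rightarrow> ereal) \<Rightarrow> bool" where
  "vanishes_before g x \<rho> \<longleftrightarrow> (\<forall>\<omega>\<in>space M. \<forall>t\<ge>0. ereal t < \<rho> \<omega> \<longrightarrow> g (x + X t \<omega>) = 0)"

lemma grid_value_excessive:
  assumes "g \<in> borel_measurable borel" "h > 0"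
  shows "ennreal (exp (- r * h)) * (\<integral>\<^sup>+z. grid_value g h (y + z) \<partial>step_law h) \<le> grid_value g h y"
  using random_walk.killed_walk_sup_excessive[OF random_walk_step_law assms(1) step_killing_prob,
      of h h y] assms(2)
  by (simp add: grid_value_def) (simp add: step_killing_prob_def)

lemma grid_value_harmonic:
  assumes "g \<in> borel_measurable borel" "h > 0" "g y = 0"
  shows "ennreal (exp (- r * h)) * (\<integral>\<^sup>+z. grid_value g h (y + z) \<partial>step_law h) = grid_value g h y"
  using random_walk.killed_walk_sup_harmonic[OF random_walk_step_law assms(1) step_killing_prob,
      of h h y] assms(2,3)
  by (simp add: grid_value_def) (simp add: step_killing_prob_def)

lemma nn_integral_discounted_step:
  assumes [measurable]: "f \<in> borel_measurable borel" and h: "h \<ge> 0" and t: "t \<ge> 0"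
    and A: "A \<in> sets (F t)"
  shows "(\<integral>\<^sup>+\<omega>. ennreal (exp (- r * (t + h))) * f (x + X (t + h) \<omega>) * indicator A \<omega> \<partial>M)
    = (\<integral>\<^sup>+\<omega>. ennreal (exp (- r * t)) * (ennreal (exp (- r * h)) *
        (\<integral>\<^sup>+z. f (x + X t \<omega> + z) \<partial>step_law h)) * indicator A \<omega> \<partial>M)"
proof -
  interpret walk: random_walk "step_law h" using h by (rule random_walk_step_law)
  let ?c = "ennreal (exp (- r * (t + h)))" and ?Z = "\<lambda>\<omega>. (indicator A \<omega> :: ennreal, x + X t \<omega>)"
  let ?p = "\<lambda>p. ?c * f (snd (fst p) + snd p) * fst (fst p)"
  have "(\<integral>\<^sup>+\<omega>. ?c * f (x + X (t + h) \<omega>) * indicator A \<omega> \<partial>M)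
      = (\<integral>\<^sup>+\<omega>. ?p (?Z \<omega>, X (t + h) \<omega> - X t \<omega>) \<partial>M)" by simp
  also have "\<dots> = (\<integral>\<^sup>+\<omega>. \<integral>\<^sup>+z. ?p (?Z \<omega>, z) \<partial>step_law h \<partial>M)"
  proof (rule nn_integral_markov[OF t])
    note A[measurable] X_adapted[OF t, measurable]
    show "?Z \<in> F t \<rightarrow>\<^sub>M borel \<Otimes>\<^sub>M borel" by measurable
  qed (fact h, measurable)
  also have "\<dots> = (\<integral>\<^sup>+\<omega>. ?c * (\<integral>\<^sup>+z. f (x + X t \<omega> + z) \<partial>step_law h) * indicator A \<omega> \<partial>M)"
    by (simp add: nn_integral_cmult nn_integral_multc)
  also have "\<dots> = (\<integral>\<^sup>+\<omega>. ennreal (exp (- r * t)) * (ennreal (exp (- r * h)) *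
        (\<integral>\<^sup>+z. f (x + X t \<omega> + z) \<partial>step_law h)) * indicator A \<omega> \<partial>M)"
  proof -
    have "?c = ennreal (exp (- r * t)) * ennreal (exp (- r * h))"
      by (simp add: ennreal_mult[symmetric] exp_add[symmetric] algebra_simps)
    then show ?thesis by (simp only: mult.assoc)
  qed
  finally show ?thesis .
qed

definition grid_stopped :: "real \<Rightarrow> ('a \<Rightarrow> ereal) \<Rightarrow> nat \<Rightarrow> 'a \<Rightarrow> ereal" where
  "grid_stopped h \<rho> K \<omega> = grid_ceiling h (min (\<rho> \<omega>) (ereal (real K * h)))"

lemma grid_stopped_nonneg: "h \<ge> 0 \<Longrightarrow> grid_stopped h \<rho> K \<omega> \<ge> 0"
  by (simp add: grid_stopped_def grid_ceiling_nonneg)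

lemma grid_stopped_measurable[measurable]:
  assumes [measurable]: "\<rho> \<in> borel_measurable M"
  shows "grid_stopped h \<rho> K \<in> borel_measurable M"
  unfolding grid_stopped_def[abs_def] by measurable

lemma disc_value_grid_stopped_Suc:
  assumes "h > 0" "\<rho> \<omega> \<le> ereal (real K * h)"
  shows "disc_value f x (grid_stopped h \<rho> (Suc K)) \<omega> = disc_value f x (grid_stopped h \<rho> K) \<omega>"
proof -
  note assms(2)
  also have "ereal (real K * h) \<le> ereal (real (Suc K) * h)" using assms(1) by simp
  finally show ?thesis
    using assms(2) by (simp add: disc_value_def grid_stopped_def min_absorb1 del: of_nat_Suc)
qed

lemma disc_value_grid_stopped_before:
  assumes "h > 0" "\<not> \<rho> \<omega> \<le> ereal (real K * h)"
  shows "disc_value f x (grid_stopped h \<rho> K) \<omega>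
      = ennreal (exp (- r * (real K * h))) * f (x + X (real K * h) \<omega>)"
    and "disc_value f x (grid_stopped h \<rho> (Suc K)) \<omega>
      = ennreal (exp (- r * (real K * h + h))) * f (x + X (real K * h + h) \<omega>)"
proof -
  have "grid_stopped h \<rho> K \<omega> = ereal (real K * h)"
    using assms by (simp add: grid_stopped_def min_absorb2 grid_ceiling_grid_point)
  moreover have "grid_stopped h \<rho> (Suc K) \<omega> = ereal (real K * h + h)"
    using assms grid_ceiling_eq_Suc[of h K "min (\<rho> \<omega>) (ereal (real (Suc K) * h))"]
    by (simp add: grid_stopped_def algebra_simps)
  ultimately show "disc_value f x (grid_stopped h \<rho> K) \<omega>
      = ennreal (exp (- r * (real K * h))) * f (x + X (real K * h) \<omega>)"
    "disc_value f x (grid_stopped h \<rho> (Suc K)) \<omega>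
      = ennreal (exp (- r * (real K * h + h))) * f (x + X (real K * h + h) \<omega>)"
    by (simp_all add: disc_value_def)
qed

lemma nn_integral_disc_value_grid_stopped:
  assumes [measurable]: "f \<in> borel_measurable borel" and h: "h > 0" and \<rho>: "stopping_time_ext F \<rho>"
  defines "A \<equiv> \<lambda>K. {\<omega>\<in>space M. \<not> \<rho> \<omega> \<le> ereal (real K * h)}"
  shows "(\<integral>\<^sup>+\<omega>. disc_value f x (grid_stopped h \<rho> K) \<omega> \<partial>M)
      = (\<integral>\<^sup>+\<omega>. disc_value f x (grid_stopped h \<rho> K) \<omega> * indicator (space M - A K) \<omega> \<partial>M)
        + (\<integral>\<^sup>+\<omega>. ennreal (exp (- r * (real K * h))) * f (x + X (real K * h) \<omega>) * indicator (A K) \<omega> \<partial>M)"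
    and "(\<integral>\<^sup>+\<omega>. disc_value f x (grid_stopped h \<rho> (Suc K)) \<omega> \<partial>M)
      = (\<integral>\<^sup>+\<omega>. disc_value f x (grid_stopped h \<rho> K) \<omega> * indicator (space M - A K) \<omega> \<partial>M)
        + (\<integral>\<^sup>+\<omega>. ennreal (exp (- r * (real K * h + h))) * f (x + X (real K * h + h) \<omega>)
            * indicator (A K) \<omega> \<partial>M)"
proof -
  note [measurable] = stopping_time_measurable[OF \<rho>]
  have [measurable]: "A K \<in> events" unfolding A_def by measurable
  have [measurable]: "disc_value f x (grid_stopped h \<rho> L) \<in> borel_measurable M" for L
    using h by (intro disc_value_measurable grid_stopped_nonneg) auto
  have split: "(\<integral>\<^sup>+\<omega>. disc_value f x (grid_stopped h \<rho> L) \<omega> \<partial>M)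
      = (\<integral>\<^sup>+\<omega>. disc_value f x (grid_stopped h \<rho> L) \<omega> * indicator (space M - A K) \<omega> \<partial>M)
        + (\<integral>\<^sup>+\<omega>. disc_value f x (grid_stopped h \<rho> L) \<omega> * indicator (A K) \<omega> \<partial>M)" for L
    by (subst nn_integral_add[symmetric]) (auto intro!: nn_integral_cong simp: indicator_def)
  show "(\<integral>\<^sup>+\<omega>. disc_value f x (grid_stopped h \<rho> K) \<omega> \<partial>M)
      = (\<integral>\<^sup>+\<omega>. disc_value f x (grid_stopped h \<rho> K) \<omega> * indicator (space M - A K) \<omega> \<partial>M)
        + (\<integral>\<^sup>+\<omega>. ennreal (exp (- r * (real K * h))) * f (x + X (real K * h) \<omega>) * indicator (A K) \<omega> \<partial>M)"
    unfolding split[of K] using h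
    by (intro arg_cong2[where f="(+)"] refl nn_integral_cong)
      (auto simp: A_def indicator_def disc_value_grid_stopped_before)
  show "(\<integral>\<^sup>+\<omega>. disc_value f x (grid_stopped h \<rho> (Suc K)) \<omega> \<partial>M)
      = (\<integral>\<^sup>+\<omega>. disc_value f x (grid_stopped h \<rho> K) \<omega> * indicator (space M - A K) \<omega> \<partial>M)
        + (\<integral>\<^sup>+\<omega>. ennreal (exp (- r * (real K * h + h))) * f (x + X (real K * h + h) \<omega>)
            * indicator (A K) \<omega> \<partial>M)"
    unfolding split[of "Suc K"] using h
    by (intro arg_cong2[where f="(+)"] nn_integral_cong)
      (auto simp: A_def indicator_def disc_value_grid_stopped_Suc disc_value_grid_stopped_before)
qed

lemma nn_integral_disc_grid_value_Suc:
  assumes g: "g \<in> borel_measurable borel" and h: "h > 0" and \<rho>: "stopping_time_ext F \<rho>"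
  shows "(\<integral>\<^sup>+\<omega>. disc_value (grid_value g h) x (grid_stopped h \<rho> (Suc K)) \<omega> \<partial>M)
      \<le> (\<integral>\<^sup>+\<omega>. disc_value (grid_value g h) x (grid_stopped h \<rho> K) \<omega> \<partial>M)"
    and "vanishes_before g x \<rho> \<Longrightarrow>
      (\<integral>\<^sup>+\<omega>. disc_value (grid_value g h) x (grid_stopped h \<rho> (Suc K)) \<omega> \<partial>M)
      = (\<integral>\<^sup>+\<omega>. disc_value (grid_value g h) x (grid_stopped h \<rho> K) \<omega> \<partial>M)"
proof -
  let ?t = "real K * h" and ?V = "grid_value g h"
  let ?next = "\<lambda>\<omega>. ennreal (exp (- r * h)) * (\<integral>\<^sup>+z. ?V (x + X ?t \<omega> + z) \<partial>step_law h)"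
  define A where "A = {\<omega>\<in>space M. \<not> \<rho> \<omega> \<le> ereal ?t}"
  have t: "?t \<ge> 0" using h by simp
  have "A = space (F ?t) - {\<omega>\<in>space M. \<rho> \<omega> \<le> ereal ?t}" by (auto simp: A_def space_F[OF t])
  then have A: "A \<in> sets (F ?t)" using stopping_time_sets[OF \<rho> t] by simp
  have V: "?V \<in> borel_measurable borel" using g h by simp
  note step = nn_integral_disc_value_grid_stopped[OF V h \<rho>, of x K, folded A_def,
      unfolded nn_integral_discounted_step[OF V less_imp_le[OF h] t A]]
  show "(\<integral>\<^sup>+\<omega>. disc_value ?V x (grid_stopped h \<rho> (Suc K)) \<omega> \<partial>M)
      \<le> (\<integral>\<^sup>+\<omega>. disc_value ?V x (grid_stopped h \<rho> K) \<omega> \<partial>M)"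
    unfolding step using grid_value_excessive[OF g h]
    by (intro add_left_mono nn_integral_mono mult_right_mono mult_left_mono) auto
  assume "vanishes_before g x \<rho>"
  then have "g (x + X ?t \<omega>) = 0" if "\<omega> \<in> A" for \<omega>
    using that h by (auto simp: vanishes_before_def A_def not_le)
  then have "(\<integral>\<^sup>+\<omega>. ennreal (exp (- r * ?t)) * ?next \<omega> * indicator A \<omega> \<partial>M)
      = (\<integral>\<^sup>+\<omega>. ennreal (exp (- r * ?t)) * ?V (x + X ?t \<omega>) * indicator A \<omega> \<partial>M)"
    using grid_value_harmonic[OF g h] by (intro nn_integral_cong) (auto simp: indicator_def)
  then show "(\<integral>\<^sup>+\<omega>. disc_value ?V x (grid_stopped h \<rho> (Suc K)) \<omega> \<partial>M)
      = (\<integral>\<^sup>+\<omega>. disc_value ?V x (grid_stopped h \<rho> K) \<omega> \<partial>M)"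
    unfolding step by simp
qed

lemma disc_value_grid_stopped_tendsto:
  assumes f: "\<And>y. f y \<le> C" and C: "C < \<infinity>" and h: "h > 0" and "\<rho> \<omega> \<ge> 0"
  shows "(\<lambda>K. disc_value f x (grid_stopped h \<rho> K) \<omega>)
    \<longlonglongrightarrow> disc_value f x (\<lambda>\<omega>. grid_ceiling h (\<rho> \<omega>)) \<omega>"
proof (cases "\<rho> \<omega> = \<infinity>")
  case False
  then obtain t where t: "\<rho> \<omega> = ereal t" using \<open>\<rho> \<omega> \<ge> 0\<close> by (cases "\<rho> \<omega>") auto
  have "eventually (\<lambda>K. t / h \<le> real K) sequentially"
    using filterlim_real_sequentially by (auto simp: filterlim_at_top)
  then have "eventually (\<lambda>K. disc_value f x (grid_stopped h \<rho> K) \<omega>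
      = disc_value f x (\<lambda>\<omega>. grid_ceiling h (\<rho> \<omega>)) \<omega>) sequentially"
    by eventually_elim
      (use h t in \<open>simp add: grid_stopped_def disc_value_def min_absorb1 pos_divide_le_eq\<close>)
  then show ?thesis by (rule tendsto_eventually)
next
  case True
  have lim: "(\<lambda>K. ennreal (exp (- r * h) ^ K) * C) \<longlonglongrightarrow> ennreal 0 * C"
    using C h r_pos
    by (intro tendsto_mult_ennreal tendsto_ennrealI tendsto_const LIMSEQ_realpow_zero) auto
  have "disc_value f x (grid_stopped h \<rho> K) \<omega> \<le> ennreal (exp (- r * h) ^ K) * C" for K
  proof -
    have "disc_value f x (grid_stopped h \<rho> K) \<omega>
        = ennreal (exp (- r * (real K * h))) * f (x + X (real K * h) \<omega>)"
      using True by (intro disc_value_grid_stopped_before(1)[OF h]) simp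
    also have "exp (- r * (real K * h)) = exp (- r * h) ^ K"
      unfolding exp_of_nat_mult[symmetric] by (simp add: mult_ac)
    finally show ?thesis using f by (simp add: mult_left_mono)
  qed
  then have "(\<lambda>K. disc_value f x (grid_stopped h \<rho> K) \<omega>) \<longlonglongrightarrow> ennreal 0 * C"
    by (intro tendsto_sandwich[OF _ _ tendsto_const lim]) auto
  then show ?thesis using True by (simp add: disc_value_def grid_ceiling_def)
qed

lemma nn_integral_disc_value_grid_stopped_tendsto:
  assumes [measurable]: "f \<in> borel_measurable borel" and f: "\<And>y. f y \<le> C" and C: "C < \<infinity>"
    and h: "h > 0" and \<rho>: "stopping_time_ext F \<rho>"
  shows "(\<lambda>K. \<integral>\<^sup>+\<omega>. disc_value f x (grid_stopped h \<rho> K) \<omega> \<partial>M)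
    \<longlonglongrightarrow> (\<integral>\<^sup>+\<omega>. disc_value f x (\<lambda>\<omega>. grid_ceiling h (\<rho> \<omega>)) \<omega> \<partial>M)"
proof (rule nn_integral_dominated_convergence[where w="\<lambda>_. C"])
  note [measurable] = stopping_time_measurable[OF \<rho>]
  show "disc_value f x (grid_stopped h \<rho> K) \<in> borel_measurable M" for K
    using h by (intro disc_value_measurable) (auto simp: grid_stopped_nonneg)
  show "disc_value f x (\<lambda>\<omega>. grid_ceiling h (\<rho> \<omega>)) \<in> borel_measurable M"
    using h by (intro disc_value_measurable) (auto simp: grid_ceiling_nonneg)
  show "AE \<omega> in M. disc_value f x (grid_stopped h \<rho> K) \<omega> \<le> C" for K
    using h by (intro AE_I2 disc_value_le f grid_stopped_nonneg) simp
  show "AE \<omega> in M. (\<lambda>K. disc_value f x (grid_stopped h \<rho> K) \<omega>)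
      \<longlonglongrightarrow> disc_value f x (\<lambda>\<omega>. grid_ceiling h (\<rho> \<omega>)) \<omega>"
    by (intro AE_I2 disc_value_grid_stopped_tendsto[OF f C h] stopping_time_nonneg[OF \<rho>])
qed (use C in \<open>auto simp: emeasure_space_1\<close>)

lemma grid_optional_sampling:
  assumes g: "g \<in> borel_measurable borel" "\<And>y. g y \<le> C" and C: "C < \<infinity>" and h: "h > 0"
    and \<rho>: "stopping_time_ext F \<rho>"
  shows "(\<integral>\<^sup>+\<omega>. disc_value (grid_value g h) x (\<lambda>\<omega>. grid_ceiling h (\<rho> \<omega>)) \<omega> \<partial>M) \<le> grid_value g h x"
    and "vanishes_before g x \<rho> \<Longrightarrow>
      (\<integral>\<^sup>+\<omega>. disc_value (grid_value g h) x (\<lambda>\<omega>. grid_ceiling h (\<rho> \<omega>)) \<omega> \<partial>M) = grid_value g h x"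
proof -
  let ?V = "grid_value g h"
  let ?I = "\<lambda>K. \<integral>\<^sup>+\<omega>. disc_value ?V x (grid_stopped h \<rho> K) \<omega> \<partial>M"
  have lim: "?I \<longlonglongrightarrow> (\<integral>\<^sup>+\<omega>. disc_value ?V x (\<lambda>\<omega>. grid_ceiling h (\<rho> \<omega>)) \<omega> \<partial>M)"
    using g h by (intro nn_integral_disc_value_grid_stopped_tendsto[OF _ _ C h \<rho>] grid_value_le) auto
  have start: "?I 0 = ?V x"
  proof -
    have "?I 0 = (\<integral>\<^sup>+\<omega>. ?V x \<partial>M)"
      using stopping_time_nonneg[OF \<rho>] X_0
      by (intro nn_integral_cong)
        (simp add: disc_value_def grid_stopped_def grid_ceiling_def min_absorb2 flip: zero_ereal_def)
    then show ?thesis by (simp add: emeasure_space_1)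
  qed
  have "?I K \<le> ?V x" for K
  proof (induction K)
    case (Suc K)
    show ?case using nn_integral_disc_grid_value_Suc(1)[OF g(1) h \<rho>] Suc by (rule order_trans)
  qed (simp add: start)
  then show "(\<integral>\<^sup>+\<omega>. disc_value ?V x (\<lambda>\<omega>. grid_ceiling h (\<rho> \<omega>)) \<omega> \<partial>M) \<le> ?V x"
    by (intro LIMSEQ_le_const2[OF lim]) auto
  assume vanish: "vanishes_before g x \<rho>"
  have "?I K = ?V x" for K
  proof (induction K)
    case (Suc K)
    show ?case using nn_integral_disc_grid_value_Suc(2)[OF g(1) h \<rho> vanish] Suc by (rule trans)
  qed (rule start)
  then show "(\<integral>\<^sup>+\<omega>. disc_value ?V x (\<lambda>\<omega>. grid_ceiling h (\<rho> \<omega>)) \<omega> \<partial>M) = ?V x"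
    using LIMSEQ_unique[OF lim] by simp
qed

lemma disc_value_grid_ceiling_tendsto:
  fixes g :: "real \<Rightarrow> real"
  assumes h: "\<And>n. h n > 0" "h \<longlonglongrightarrow> 0"
    and g: "mono g" "continuous_on UNIV g" "\<And>y. g y \<le> C"
    and \<omega>: "\<omega> \<in> space M" "\<rho> \<omega> \<ge> 0"
  shows "(\<lambda>n. disc_value (grid_value (\<lambda>z. ennreal (g z)) (h n)) x (\<lambda>\<omega>. grid_ceiling (h n) (\<rho> \<omega>)) \<omega>)
    \<longlonglongrightarrow> disc_value (sup_value g) x \<rho> \<omega>"
proof (cases "\<rho> \<omega> = \<infinity>")
  case True
  then show ?thesis by (simp add: disc_value_def grid_ceiling_def)
next
  case False
  then obtain t where t: "\<rho> \<omega> = ereal t" "t \<ge> 0" using \<omega>(2) by (cases "\<rho> \<omega>") auto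
  let ?t = "\<lambda>n. real (nat \<lceil>t / h n\<rceil>) * h n"
  have "(\<lambda>n. ennreal (exp (- r * ?t n)) * grid_value (\<lambda>z. ennreal (g z)) (h n) (x + X (?t n) \<omega>))
      \<longlonglongrightarrow> ennreal (exp (- r * t)) * sup_value g (x + X t \<omega>)"
  proof (rule tendsto_mult_ennreal)
    show "(\<lambda>n. ennreal (exp (- r * ?t n))) \<longlonglongrightarrow> ennreal (exp (- r * t))"
      by (intro tendsto_ennrealI tendsto_exp tendsto_mult tendsto_const grid_ceiling_tendsto t h)
    show "(\<lambda>n. grid_value (\<lambda>z. ennreal (g z)) (h n) (x + X (?t n) \<omega>)) \<longlonglongrightarrow> sup_value g (x + X t \<omega>)"
      by (intro grid_value_tendsto_sup_value[OF h g] tendsto_add tendsto_const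
          cadlag_grid_ceiling_tendsto[OF cadlag_X[OF \<omega>(1)] t(2) h])
  qed simp
  then show ?thesis by (simp add: disc_value_def grid_ceiling_def t)
qed

lemma optional_sampling_bounded:
  fixes g :: "real \<Rightarrow> real"
  assumes g: "mono g" "continuous_on UNIV g" "\<And>y. g y \<le> C" and \<rho>: "stopping_time_ext F \<rho>"
  shows "(\<integral>\<^sup>+\<omega>. disc_value (sup_value g) x \<rho> \<omega> \<partial>M) \<le> sup_value g x"
    and "vanishes_before g x \<rho> \<Longrightarrow> (\<integral>\<^sup>+\<omega>. disc_value (sup_value g) x \<rho> \<omega> \<partial>M) = sup_value g x"
proof -
  let ?g = "\<lambda>z. ennreal (g z)"
  define h where "h n = 1 / real (Suc n)" for n
  have h: "h n > 0" "h \<longlonglongrightarrow> 0" for n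
    unfolding h_def by (simp, rule LIMSEQ_Suc[OF lim_1_over_n])
  let ?W = "\<lambda>n. disc_value (grid_value ?g (h n)) x (\<lambda>\<omega>. grid_ceiling (h n) (\<rho> \<omega>))"
  have [measurable]: "g \<in> borel_measurable borel"
    using g(2) by (rule borel_measurable_continuous_onI)
  have g': "?g \<in> borel_measurable borel" "\<And>y. ?g y \<le> ennreal C" "ennreal C < \<infinity>"
    using g(3) by (auto intro: ennreal_leI)
  note [measurable] = stopping_time_measurable[OF \<rho>] and \<rho>_nonneg = stopping_time_nonneg[OF \<rho>]
  have lim: "(\<lambda>n. \<integral>\<^sup>+\<omega>. ?W n \<omega> \<partial>M) \<longlonglongrightarrow> (\<integral>\<^sup>+\<omega>. disc_value (sup_value g) x \<rho> \<omega> \<partial>M)"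
  proof (rule nn_integral_dominated_convergence[where w="\<lambda>_. ennreal C"])
    show "?W n \<in> borel_measurable M" for n
      using g'(1) h(1)[of n] by (intro disc_value_measurable) (auto simp: grid_ceiling_nonneg)
    show "disc_value (sup_value g) x \<rho> \<in> borel_measurable M"
      by (intro disc_value_measurable \<rho>_nonneg) auto
    show "AE \<omega> in M. ?W n \<omega> \<le> ennreal C" for n
      using h(1)[of n] g'(2) by (intro AE_I2 disc_value_le grid_value_le grid_ceiling_nonneg) auto
    show "AE \<omega> in M. (\<lambda>n. ?W n \<omega>) \<longlonglongrightarrow> disc_value (sup_value g) x \<rho> \<omega>"
      by (intro AE_I2 disc_value_grid_ceiling_tendsto[OF h g] \<rho>_nonneg)
  qed (auto simp: emeasure_space_1)
  have lim_val: "(\<lambda>n. grid_value ?g (h n) x) \<longlonglongrightarrow> sup_value g x"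
    by (rule grid_value_tendsto_sup_value[OF h g tendsto_const])
  show "(\<integral>\<^sup>+\<omega>. disc_value (sup_value g) x \<rho> \<omega> \<partial>M) \<le> sup_value g x"
    by (rule LIMSEQ_le[OF lim lim_val]) (use grid_optional_sampling(1)[OF g' h(1) \<rho>] in blast)
  assume "vanishes_before g x \<rho>"
  then have "vanishes_before ?g x \<rho>" by (simp add: vanishes_before_def)
  then have "(\<integral>\<^sup>+\<omega>. ?W n \<omega> \<partial>M) = grid_value ?g (h n) x" for n
    by (rule grid_optional_sampling(2)[OF g' h(1) \<rho>])
  then show "(\<integral>\<^sup>+\<omega>. disc_value (sup_value g) x \<rho> \<omega> \<partial>M) = sup_value g x"
    using LIMSEQ_unique[OF lim] lim_val by simp
qed

lemma sup_value_eq_SUP_truncated: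
  fixes g :: "real \<Rightarrow> real"
  assumes [measurable]: "g \<in> borel_measurable borel"
  shows "incseq (\<lambda>n. sup_value (\<lambda>z. min (g z) (real n)) y)"
    and "sup_value g y = (SUP n. sup_value (\<lambda>z. min (g z) (real n)) y)"
proof -
  have inc: "incseq (\<lambda>n. ennreal (min (g z) (real n)))" for z
    by (intro incseq_SucI ennreal_leI) auto
  show "incseq (\<lambda>n. sup_value (\<lambda>z. min (g z) (real n)) y)"
    unfolding sup_value_def using inc by (intro monoI nn_integral_mono) (auto dest: monoD)
  have "(SUP n. ennreal (min (g z) (real n))) = ennreal (g z)" for z
  proof (rule LIMSEQ_unique[OF LIMSEQ_SUP[OF inc]])
    obtain N where N: "g z \<le> real N" using real_arch_simple by blast
    have "eventually (\<lambda>n. ennreal (min (g z) (real n)) = ennreal (g z)) sequentially"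
      using eventually_ge_at_top[of N] by eventually_elim (use N in \<open>auto simp: min_def\<close>)
    then show "(\<lambda>n. ennreal (min (g z) (real n))) \<longlonglongrightarrow> ennreal (g z)" by (rule tendsto_eventually)
  qed
  then have "sup_value g y = (\<integral>\<^sup>+\<omega>. (SUP n. ennreal (min (g (y + killed_sup \<omega>)) (real n))) \<partial>M)"
    by (simp add: sup_value_def)
  also have "\<dots> = (SUP n. sup_value (\<lambda>z. min (g z) (real n)) y)"
    unfolding sup_value_def using inc
    by (intro nn_integral_monotone_convergence_SUP) (auto simp: incseq_def le_fun_def)
  finally show "sup_value g y = (SUP n. sup_value (\<lambda>z. min (g z) (real n)) y)" .
qed

lemma optional_sampling:
  fixes g :: "real \<Rightarrow> real"
  assumes g: "mono g" "continuous_on UNIV g" and \<rho>: "stopping_time_ext F \<rho>"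
  shows "(\<integral>\<^sup>+\<omega>. disc_value (sup_value g) x \<rho> \<omega> \<partial>M) \<le> sup_value g x"
    and "vanishes_before g x \<rho> \<Longrightarrow> (\<integral>\<^sup>+\<omega>. disc_value (sup_value g) x \<rho> \<omega> \<partial>M) = sup_value g x"
proof -
  define g' where "g' n z = min (g z) (real n)" for n :: nat and z
  have g': "mono (g' n)" "continuous_on UNIV (g' n)" "\<And>y. g' n y \<le> real n" for n
    using g by (auto simp: g'_def mono_def min_le_iff_disj intro!: continuous_intros)
  have [measurable]: "g \<in> borel_measurable borel" "g' n \<in> borel_measurable borel" for n
    by (intro borel_measurable_continuous_onI g g')+
  have inc: "incseq (\<lambda>n. sup_value (g' n) y)" and SUP: "sup_value g y = (SUP n. sup_value (g' n) y)"
    for y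
    unfolding g'_def by (rule sup_value_eq_SUP_truncated; measurable)+
  have "disc_value (sup_value g) x \<rho> \<omega> = (SUP n. disc_value (sup_value (g' n)) x \<rho> \<omega>)" for \<omega>
    unfolding disc_value_def SUP by (simp add: SUP_mult_left_ennreal)
  then have "(\<integral>\<^sup>+\<omega>. disc_value (sup_value g) x \<rho> \<omega> \<partial>M)
      = (\<integral>\<^sup>+\<omega>. (SUP n. disc_value (sup_value (g' n)) x \<rho> \<omega>) \<partial>M)"
    by (simp only:)
  also have "\<dots> = (SUP n. \<integral>\<^sup>+\<omega>. disc_value (sup_value (g' n)) x \<rho> \<omega> \<partial>M)"
  proof (rule nn_integral_monotone_convergence_SUP)
    show "incseq (\<lambda>n. disc_value (sup_value (g' n)) x \<rho>)"
      using inc by (auto simp: incseq_def le_fun_def disc_value_def intro!: mult_left_mono)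
    show "disc_value (sup_value (g' n)) x \<rho> \<in> borel_measurable M" for n
      using stopping_time_measurable[OF \<rho>] stopping_time_nonneg[OF \<rho>]
      by (intro disc_value_measurable) auto
  qed
  finally have int: "(\<integral>\<^sup>+\<omega>. disc_value (sup_value g) x \<rho> \<omega> \<partial>M)
      = (SUP n. \<integral>\<^sup>+\<omega>. disc_value (sup_value (g' n)) x \<rho> \<omega> \<partial>M)" .
  show "(\<integral>\<^sup>+\<omega>. disc_value (sup_value g) x \<rho> \<omega> \<partial>M) \<le> sup_value g x"
    unfolding int SUP[of x] using optional_sampling_bounded(1)[OF g' \<rho>] by (intro SUP_mono) blast
  assume "vanishes_before g x \<rho>"
  then have "vanishes_before (g' n) x \<rho>" for n by (simp add: vanishes_before_def g'_def)
  then show "(\<integral>\<^sup>+\<omega>. disc_value (sup_value g) x \<rho> \<omega> \<partial>M) = sup_value g x"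
    unfolding int SUP[of x] using optional_sampling_bounded(2)[OF g' \<rho>] by simp
qed

end

section \<open>The components of the value function\<close>

text \<open>With \<open>a = r\<^sub>I\<close>, \<open>c = x\<^sub>S\<close> and \<open>k = - F\<^sub>S A\<^sub>I\<close> this is the function \<open>Q\<close> above.\<close>

definition hinge :: "real \<Rightarrow> real \<Rightarrow> real \<Rightarrow> real \<Rightarrow> real" where
  "hinge a k c y = max 0 (y - c) - k * (1 - exp (- a * max 0 (y - c)))"

definition hinge_slope :: "real \<Rightarrow> real \<Rightarrow> real \<Rightarrow> real \<Rightarrow> real" where
  "hinge_slope a k c z = 1 - a * k * exp (- a * (z - c))"

lemma hinge_eq_0: "y \<le> c \<Longrightarrow> hinge a k c y = 0"
  by (simp add: hinge_def)

lemma hinge_continuous: "continuous_on UNIV (hinge a k c)"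
  unfolding hinge_def by (intro continuous_intros)

lemma hinge_measurable[measurable]: "hinge a k c \<in> borel_measurable borel"
  by (intro borel_measurable_continuous_onI hinge_continuous)

lemma hinge_slope_measurable[measurable]: "hinge_slope a k c \<in> borel_measurable borel"
  unfolding hinge_slope_def[abs_def] by measurable

lemma hinge_antiderivative_slope:
  "((\<lambda>z. (z - c) - k * (1 - exp (- a * (z - c)))) has_real_derivative hinge_slope a k c z) (at z)"
  by (auto intro!: derivative_eq_intros simp: hinge_slope_def)

text \<open>The expectation of \<open>hinge a k c (y + S)\<close> when \<open>S \<ge> 0\<close> and \<open>P (S > s) = (1 - q) * exp (- b * s)\<close>
  for \<open>s \<ge> 0\<close>.\<close>

definition hinge_mean :: "real \<Rightarrow> real \<Rightarrow> real \<Rightarrow> real \<Rightarrow> real \<Rightarrow> real \<Rightarrow> real" where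
  "hinge_mean a b q k c y = (let m = max c y in hinge a k c y +
     (1 - q) * (exp (- b * (m - y)) / b - a * k * exp (- a * (m - c) - b * (m - y)) / (a + b)))"

lemma hinge_mean_measurable[measurable]: "hinge_mean a b q k c \<in> borel_measurable borel"
  unfolding hinge_mean_def[abs_def] Let_def by measurable

context
  fixes a k :: real
  assumes a: "a > 0" and k: "k \<ge> 0" "a * k \<le> 1"
begin

lemma hinge_slope_nonneg:
  assumes "c \<le> z"
  shows "hinge_slope a k c z \<ge> 0"
proof -
  have "a * k * exp (- a * (z - c)) \<le> a * k * 1"
    using a k assms by (intro mult_left_mono) auto
  then show ?thesis using k by (simp add: hinge_slope_def)
qed

lemma hinge_mono: "mono (hinge a k c)"
proof (rule monoI)
  fix x y :: real assume "x \<le> y"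
  then have "max c x \<le> max c y" by simp
  then have "(max c x - c) - k * (1 - exp (- a * (max c x - c)))
      \<le> (max c y - c) - k * (1 - exp (- a * (max c y - c)))"
  proof (rule DERIV_nonneg_imp_nondecreasing)
    fix z assume "max c x \<le> z"
    then have "hinge_slope a k c z \<ge> 0" by (intro hinge_slope_nonneg) simp
    then show "\<exists>d. ((\<lambda>z. (z - c) - k * (1 - exp (- a * (z - c)))) has_real_derivative d) (at z)
        \<and> 0 \<le> d"
      using hinge_antiderivative_slope by blast
  qed
  moreover have "max c z - c = max 0 (z - c)" for z by simp
  ultimately show "hinge a k c x \<le> hinge a k c y" by (simp only: hinge_def)
qed

lemma hinge_nonneg: "hinge a k c y \<ge> 0"
  using monoD[OF hinge_mono, of "min c y" y c] hinge_eq_0[of "min c y" c a k] by simp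

lemma hinge_eq_nn_integral:
  "ennreal (hinge a k c y)
    = (\<integral>\<^sup>+z. ennreal (hinge_slope a k c z) * indicator {c..} z * indicator {..<y} z \<partial>lborel)"
proof (cases "c \<le> y")
  case True
  have "(\<integral>\<^sup>+z. ennreal (hinge_slope a k c z) * indicator {c..} z * indicator {..<y} z \<partial>lborel)
     = (\<integral>\<^sup>+z. ennreal (hinge_slope a k c z) * indicator {c..y} z \<partial>lborel)"
    by (intro nn_integral_cong_AE AE_I[where N="{y}"]) (auto simp: indicator_def split: if_splits)
  also have "\<dots>
      = ennreal (((y - c) - k * (1 - exp (- a * (y - c)))) - ((c - c) - k * (1 - exp (- a * (c - c)))))"
    by (rule nn_integral_FTC_Icc[OF _ hinge_antiderivative_slope hinge_slope_nonneg True]) simp_all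
  finally show ?thesis using True by (simp add: hinge_def max_absorb2)
next
  case False
  have "(\<integral>\<^sup>+z. ennreal (hinge_slope a k c z) * indicator {c..} z * indicator {..<y} z \<partial>lborel)
     = (\<integral>\<^sup>+z. 0 \<partial>(lborel :: real measure))"
    using False by (intro nn_integral_cong) (auto simp: indicator_def)
  then show ?thesis using False by (simp add: hinge_eq_0)
qed

lemma hinge_mean_ge_hinge:
  assumes b: "b > 0" and q: "q \<le> 1"
  shows "hinge a k c y \<le> hinge_mean a b q k c y"
proof -
  define m where "m = max c y"
  have "a * k * exp (- a * (m - c) - b * (m - y)) = (1 - hinge_slope a k c m) * exp (- b * (m - y))"
    by (simp add: hinge_slope_def exp_add[symmetric])
  also have "\<dots> \<le> 1 * exp (- b * (m - y))"
    using hinge_slope_nonneg[of c m] by (intro mult_right_mono) (auto simp: m_def)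
  finally have "a * k * exp (- a * (m - c) - b * (m - y)) / (a + b) \<le> exp (- b * (m - y)) / b"
    using a b by (intro frac_le) auto
  then have
    "0 \<le> (1 - q) * (exp (- b * (m - y)) / b - a * k * exp (- a * (m - c) - b * (m - y)) / (a + b))"
    using q by (intro mult_nonneg_nonneg) auto
  then show ?thesis by (simp add: hinge_mean_def m_def Let_def)
qed

lemma hinge_mean_nonneg: "b > 0 \<Longrightarrow> q \<le> 1 \<Longrightarrow> hinge_mean a b q k c y \<ge> 0"
  using hinge_nonneg hinge_mean_ge_hinge by (rule order_trans)

lemma nn_integral_hinge_slope_exp:
  assumes b: "b > 0" and q: "q \<le> 1" and m: "c \<le> m"
  shows "(\<integral>\<^sup>+z. ennreal (hinge_slope a k c z * ((1 - q) * exp (- b * (z - y)))) * indicator {m..} z \<partial>lborel)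
    = ennreal ((1 - q) * (exp (- b * (m - y)) / b - a * k * exp (- a * (m - c) - b * (m - y)) / (a + b)))"
proof -
  define H where
    "H z = exp (- b * (z - y)) / b - a * k * (exp (- a * (z - c) - b * (z - y)) / (a + b))" for z
  have product: "hinge_slope a k c z * exp (- b * (z - y))
      = exp (- b * (z - y)) - a * k * exp (- a * (z - c) - b * (z - y))" for z
    by (simp add: hinge_slope_def left_diff_distrib exp_add[symmetric])
  have "((\<lambda>z. - ((1 - q) * H z)) has_real_derivative
      hinge_slope a k c z * ((1 - q) * exp (- b * (z - y)))) (at z)" for z
  proof -
    have E: "((\<lambda>z. exp (u - l * z) / l) has_real_derivative - exp (u - l * z)) (at z)"
      if "l > 0" for u l
      using that by (auto intro!: derivative_eq_intros)
    have "- b * (z - y) = b * y - b * z"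
      "- a * (z - c) - b * (z - y) = (a * c + b * y) - (a + b) * z" for z
      by (simp_all add: algebra_simps)
    then have "((\<lambda>z. exp (- b * (z - y)) / b) has_real_derivative - exp (- b * (z - y))) (at z)"
      "((\<lambda>z. exp (- a * (z - c) - b * (z - y)) / (a + b)) has_real_derivative
        - exp (- a * (z - c) - b * (z - y))) (at z)"
      using E[of b "b * y"] E[of "a + b" "a * c + b * y"] a b by simp_all
    from DERIV_diff[OF this(1) DERIV_cmult[OF this(2), of "a * k"]]
    have "(H has_real_derivative - (hinge_slope a k c z * exp (- b * (z - y)))) (at z)"
      unfolding product H_def[abs_def] by simp
    then show ?thesis by (auto intro!: derivative_eq_intros)
  qed
  moreover have "((\<lambda>z. - ((1 - q) * H z)) \<longlongrightarrow> 0) at_top"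
  proof -
    have "filterlim (\<lambda>z. - b * (z - y)) at_bot at_top"
      "filterlim (\<lambda>z. - a * (z - c) - b * (z - y)) at_bot at_top"
      using a b by real_asymp+
    then have "((\<lambda>z. - ((1 - q) * H z)) \<longlongrightarrow> - ((1 - q) * (0 / b - a * k * (0 / (a + b))))) at_top"
      unfolding H_def using a b by (intro tendsto_intros filterlim_compose[OF exp_at_bot]) auto
    then show ?thesis by simp
  qed
  moreover have "0 \<le> hinge_slope a k c z * ((1 - q) * exp (- b * (z - y)))" if "m \<le> z" for z
    using hinge_slope_nonneg[of c z] m q that by simp
  ultimately have "(\<integral>\<^sup>+z. ennreal (hinge_slope a k c z * ((1 - q) * exp (- b * (z - y)))) * indicator {m..} z \<partial>lborel)
      = ennreal (0 - - ((1 - q) * H m))"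
    by (intro nn_integral_FTC_atLeast) auto
  then show ?thesis by (simp add: H_def)
qed

end

section \<open>Killed Levy processes with exponential supremum\<close>

lemma (in prob_space) nn_integral_lessThan_random_variable:
  fixes Y :: "'a \<Rightarrow> real"
  assumes [measurable]: "Y \<in> borel_measurable M" "w \<in> borel_measurable borel"
  shows "(\<integral>\<^sup>+\<omega>. \<integral>\<^sup>+z. w z * indicator {..<Y \<omega>} z \<partial>lborel \<partial>M)
    = (\<integral>\<^sup>+z. w z * emeasure M {\<omega>\<in>space M. z < Y \<omega>} \<partial>lborel)"
proof -
  interpret pair_sigma_finite lborel M ..
  have "(\<integral>\<^sup>+\<omega>. \<integral>\<^sup>+z. w z * indicator {..<Y \<omega>} z \<partial>lborel \<partial>M)
      = (\<integral>\<^sup>+\<omega>. \<integral>\<^sup>+z. w z * indicator {p. fst p < snd p} (z, Y \<omega>) \<partial>lborel \<partial>M)"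
    by (intro nn_integral_cong) (simp add: indicator_def)
  also have "\<dots> = (\<integral>\<^sup>+z. \<integral>\<^sup>+\<omega>. w z * indicator {p. fst p < snd p} (z, Y \<omega>) \<partial>M \<partial>lborel)"
    by (rule Fubini') measurable
  also have "\<dots> = (\<integral>\<^sup>+z. \<integral>\<^sup>+\<omega>. w z * indicator {\<omega>\<in>space M. z < Y \<omega>} \<omega> \<partial>M \<partial>lborel)"
    by (intro nn_integral_cong) (simp add: indicator_def)
  also have "\<dots> = (\<integral>\<^sup>+z. w z * emeasure M {\<omega>\<in>space M. z < Y \<omega>} \<partial>lborel)"
    by (intro nn_integral_cong nn_integral_cmult_indicator) measurable
  finally show ?thesis .
qed

locale exp_sup_levy = killed_levy M F X er r
  for M :: "'a measure" and F X er r +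
  fixes q b :: real
  assumes b_pos: "b > 0" and q: "0 \<le> q" "q < 1"
    and law_sup: "\<forall>y\<ge>0. measure M {\<omega>\<in>space M. Sup ((\<lambda>t. X t \<omega>) ` {0..er \<omega>}) > y}
        = (1 - q) * exp (- b * y)"
begin

lemma prob_killed_sup_gt:
  assumes "y \<ge> 0"
  shows "prob {\<omega>\<in>space M. y < killed_sup \<omega>} = (1 - q) * exp (- b * y)"
proof -
  let ?A = "{\<omega>\<in>space M. Sup ((\<lambda>t. X t \<omega>) ` {0..er \<omega>}) > y}"
  have A: "prob ?A = (1 - q) * exp (- b * y)" using law_sup assms by blast
  then have "prob ?A \<noteq> 0" using q by simp
  then have "?A \<in> events" using measure_notin_sets by blast
  then have "prob {\<omega>\<in>space M. y < killed_sup \<omega>} = prob ?A"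
  proof (intro measure_eq_AE)
    show "AE \<omega> in M. \<omega> \<in> {\<omega>\<in>space M. y < killed_sup \<omega>} \<longleftrightarrow> \<omega> \<in> ?A"
      using AE_er_pos by eventually_elim (simp add: killed_sup_def running_sup_def max_def)
    show "{\<omega>\<in>space M. y < killed_sup \<omega>} \<in> events" by measurable
  qed
  then show ?thesis using A by simp
qed

lemma prob_killed_sup_eq_0:
  assumes "y > 0"
  shows "prob {\<omega>\<in>space M. killed_sup \<omega> = y} = 0"
proof -
  define \<epsilon> where "\<epsilon> n = y / real (Suc n)" for n
  have "prob {\<omega>\<in>space M. killed_sup \<omega> = y}
      \<le> (1 - q) * exp (- b * (y - \<epsilon> n)) - (1 - q) * exp (- b * y)" for n
  proof -
    have \<epsilon>: "0 < \<epsilon> n" "\<epsilon> n \<le> y" using assms by (auto simp: \<epsilon>_def field_simps)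
    have "prob {\<omega>\<in>space M. killed_sup \<omega> = y}
        \<le> prob ({\<omega>\<in>space M. y - \<epsilon> n < killed_sup \<omega>} - {\<omega>\<in>space M. y < killed_sup \<omega>})"
      using \<epsilon> by (intro finite_measure_mono) auto
    also have "\<dots> = prob {\<omega>\<in>space M. y - \<epsilon> n < killed_sup \<omega>} - prob {\<omega>\<in>space M. y < killed_sup \<omega>}"
      using \<epsilon> by (intro finite_measure_Diff) auto
    finally show ?thesis using \<epsilon> assms by (simp add: prob_killed_sup_gt)
  qed
  moreover have "(\<lambda>n. (1 - q) * exp (- b * (y - \<epsilon> n)) - (1 - q) * exp (- b * y))
      \<longlonglongrightarrow> (1 - q) * exp (- b * (y - 0)) - (1 - q) * exp (- b * y)"
    unfolding \<epsilon>_def by (intro tendsto_intros LIMSEQ_Suc[OF lim_const_over_n])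
  ultimately have "prob {\<omega>\<in>space M. killed_sup \<omega> = y} \<le> 0"
    by (intro LIMSEQ_le_const) auto
  then show ?thesis by (simp add: antisym)
qed

lemma emeasure_less_add_killed_sup:
  "emeasure M {\<omega>\<in>space M. z < y + killed_sup \<omega>}
    = indicator {..<y} z + ennreal ((1 - q) * exp (- b * (z - y))) * indicator {y..} z"
proof (cases "z < y")
  case True
  then have "{\<omega>\<in>space M. z < y + killed_sup \<omega>} = space M"
    using killed_sup_nonneg by (force intro: add_strict_increasing)
  then show ?thesis using True by (simp add: emeasure_space_1)
next
  case False
  then have "{\<omega>\<in>space M. z < y + killed_sup \<omega>} = {\<omega>\<in>space M. z - y < killed_sup \<omega>}" by auto
  then show ?thesis using False by (simp add: emeasure_eq_measure prob_killed_sup_gt)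
qed

lemma sup_value_hinge:
  assumes ak: "a > 0" "k \<ge> 0" "a * k \<le> 1"
  shows "sup_value (hinge a k c) y = ennreal (hinge_mean a b q k c y)"
proof -
  let ?w = "\<lambda>z. ennreal (hinge_slope a k c z) * indicator {c..} z"
  let ?tail = "\<lambda>z. ennreal (hinge_slope a k c z * ((1 - q) * exp (- b * (z - y)))) * indicator {max c y..} z"
  have "sup_value (hinge a k c) y
      = (\<integral>\<^sup>+z. ?w z * emeasure M {\<omega>\<in>space M. z < y + killed_sup \<omega>} \<partial>lborel)"
    unfolding sup_value_def hinge_eq_nn_integral[OF ak]
    by (rule nn_integral_lessThan_random_variable) measurable
  also have "\<dots> = (\<integral>\<^sup>+z. ?w z * indicator {..<y} z + ?tail z \<partial>lborel)"
    using hinge_slope_nonneg[OF ak, of c] q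
    by (intro nn_integral_cong) (auto simp: emeasure_less_add_killed_sup indicator_def ennreal_mult)
  also have "\<dots> = ennreal (hinge a k c y) + (\<integral>\<^sup>+z. ?tail z \<partial>lborel)"
    unfolding hinge_eq_nn_integral[OF ak] by (rule nn_integral_add) measurable
  also have "\<dots> = ennreal (hinge a k c y) + ennreal (hinge_mean a b q k c y - hinge a k c y)"
    using nn_integral_hinge_slope_exp[OF ak b_pos, of q c "max c y" y] q
    by (simp add: hinge_mean_def Let_def)
  also have "\<dots> = ennreal (hinge_mean a b q k c y)"
    using hinge_nonneg[OF ak, of c y] hinge_mean_ge_hinge[OF ak b_pos, of q c y] q
    by (simp flip: ennreal_plus)
  finally show ?thesis .
qed

end

section \<open>Hitting times\<close>

lemma hit_above_nonneg: "hit_above X x c \<omega> \<ge> 0"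
  by (auto simp: hit_above_def intro!: cInf_greatest)

lemma hit_below_eq_hit_above_uminus: "hit_below X x c = hit_above (\<lambda>t \<omega>. - X t \<omega>) (- x) (- c)"
proof -
  have "x + z \<le> c \<longleftrightarrow> - c \<le> - x + - z" for z :: real by linarith
  then show ?thesis by (simp add: hit_below_def hit_above_def fun_eq_iff)
qed

context levy
begin

lemma hit_above_le_iff:
  assumes \<omega>: "\<omega> \<in> space M"
  shows "hit_above X x c \<omega> \<le> ereal t \<longleftrightarrow> (\<exists>s. 0 \<le> s \<and> s \<le> t \<and> c \<le> x + X s \<omega>)"
proof -
  define A where "A = {t. 0 \<le> t \<and> c \<le> x + X t \<omega>}"
  have bdd: "bdd_below A" by (auto simp: A_def intro: bdd_belowI[of _ 0])
  show ?thesis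
  proof (cases "A = {}")
    case True
    then show ?thesis by (auto simp: hit_above_def A_def)
  next
    case False
    have "Inf A \<in> A"
    proof -
      from closure_contains_Inf[OF False bdd] obtain s where s: "\<And>n. s n \<in> A" "s \<longlonglongrightarrow> Inf A"
        unfolding closure_sequential by blast
      have nonneg: "0 \<le> Inf A" using False by (intro cInf_greatest) (auto simp: A_def)
      have "(\<lambda>n. x + X (s n) \<omega>) \<longlonglongrightarrow> x + X (Inf A) \<omega>"
        using s bdd nonneg
        by (intro tendsto_add tendsto_const cadlag_tendsto_from_right[OF cadlag_X[OF \<omega>]] cInf_lower) auto
      then have "c \<le> x + X (Inf A) \<omega>"
        using s(1) by (intro LIMSEQ_le_const) (auto simp: A_def)
      then show ?thesis using nonneg by (simp add: A_def)
    qed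
    moreover have "hit_above X x c \<omega> = ereal (Inf A)"
      using False by (auto simp: hit_above_def A_def)
    moreover have "s \<in> A \<Longrightarrow> Inf A \<le> s" for s using bdd by (intro cInf_lower)
    ultimately show ?thesis unfolding A_def by (auto intro: order_trans)
  qed
qed

lemma less_before_hit_above:
  assumes "\<omega> \<in> space M" "0 \<le> t" "ereal t < hit_above X x c \<omega>"
  shows "x + X t \<omega> < c"
proof (rule ccontr)
  assume "\<not> x + X t \<omega> < c"
  then have "hit_above X x c \<omega> \<le> ereal t"
    unfolding hit_above_le_iff[OF assms(1)] using assms(2) by (intro exI[of _ t]) auto
  then show False using assms(3) by simp
qed

lemma hit_above_attained:
  assumes "\<omega> \<in> space M" "hit_above X x c \<omega> = ereal t"
  shows "c \<le> x + X t \<omega>"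
proof -
  obtain s where s: "0 \<le> s" "s \<le> t" "c \<le> x + X s \<omega>"
    using assms hit_above_le_iff[OF assms(1), of x c t] by auto
  then have "hit_above X x c \<omega> \<le> ereal s" unfolding hit_above_le_iff[OF assms(1)] by blast
  then have "s = t" using s assms(2) by simp
  then show ?thesis using s by simp
qed

lemma running_sup_adapted: "t \<ge> 0 \<Longrightarrow> running_sup t \<in> borel_measurable (F t)"
  by (intro running_sup_measurable space_F X_measurable_F) (auto simp: mult_left_le_one_le)

lemma hit_above_le_if_less_running_sup:
  assumes "\<omega> \<in> space M" "0 \<le> t" "c - x < running_sup t \<omega>"
  shows "hit_above X x c \<omega> \<le> ereal t"
proof -
  obtain s where "s \<in> {0..t}" "c - x < X s \<omega>"
    using assms unfolding running_sup_def
    by (subst (asm) less_cSUP_iff[OF _ cadlag_bdd_above[OF cadlag_X]]) auto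
  then show ?thesis unfolding hit_above_le_iff[OF assms(1)] by (intro exI[of _ s]) auto
qed

end

context exp_sup_levy
begin

text \<open>On the event below, a killing time in \<open>(s, t]\<close> makes the supremum equal to \<open>c\<close>, which is not an
  atom of its law.\<close>

lemma running_sup_stuck_null:
  assumes c: "c > 0" and st: "0 \<le> s" "s < t"
  shows "{\<omega>\<in>space M. c \<le> running_sup s \<omega> \<and> running_sup t \<omega> \<le> c} \<in> null_sets M"
proof -
  let ?A = "{\<omega>\<in>space M. c \<le> running_sup s \<omega> \<and> running_sup t \<omega> \<le> c}"
  let ?E = "er -` {s<..t} \<inter> space M"
  have A: "?A \<in> sets path_algebra"
  proof -
    have [measurable]: "running_sup s \<in> borel_measurable path_algebra"
      "running_sup t \<in> borel_measurable path_algebra"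
      using st
      by (auto intro!: running_sup_measurable X_measurable_path_algebra simp: space_measure_of_conv)
    have "{\<omega>\<in>space path_algebra. c \<le> running_sup s \<omega> \<and> running_sup t \<omega> \<le> c} \<in> sets path_algebra"
      by measurable
    then show ?thesis by (simp add: space_measure_of_conv)
  qed
  then have [measurable]: "?A \<in> events" using sets_path_algebra_subset by blast
  have "prob ?E * prob ?A = prob (?E \<inter> ?A)"
    by (rule indep_setD[OF er_indep _ A[unfolded sets_path_algebra], symmetric]) auto
  also have "\<dots> \<le> prob {\<omega>\<in>space M. killed_sup \<omega> = c}"
  proof (intro finite_measure_mono subsetI)
    fix \<omega> assume "\<omega> \<in> ?E \<inter> ?A"
    then have \<omega>: "\<omega> \<in> space M" "s < er \<omega>" "er \<omega> \<le> t" "c \<le> running_sup s \<omega>" "running_sup t \<omega> \<le> c"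
      by auto
    have "running_sup s \<omega> \<le> killed_sup \<omega>" "killed_sup \<omega> \<le> running_sup t \<omega>"
      unfolding killed_sup_def using \<omega> st by (auto intro!: running_sup_mono)
    then show "\<omega> \<in> {\<omega>\<in>space M. killed_sup \<omega> = c}" using \<omega> by simp
  qed measurable
  also have "\<dots> = 0" by (rule prob_killed_sup_eq_0[OF c])
  finally have "prob ?E * prob ?A \<le> 0" .
  moreover have "?E = {\<omega>\<in>space M. s < er \<omega> \<and> er \<omega> \<le> t}" by auto
  then have "prob ?E > 0" using prob_er_Ioc[of s t] st r_pos by simp
  ultimately have "prob ?A = 0" by (simp add: mult_le_0_iff antisym)
  then show ?thesis by (intro null_setsI) (auto simp: emeasure_eq_measure)
qed

lemma running_sup_reaches_without_hit_null:
  assumes "x < c" and t: "t \<ge> 0"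
  obtains N where "N \<in> null_sets M"
    "{\<omega>\<in>space M. c - x \<le> running_sup t \<omega> \<and> \<not> hit_above X x c \<omega> \<le> ereal t} \<subseteq> N"
proof
  define stuck where
    "stuck n = {\<omega>\<in>space M. c - x \<le> running_sup t \<omega> \<and> running_sup (t + 1 / real (Suc n)) \<omega> \<le> c - x}"
      for n
  show "(\<Union>n. stuck n) \<in> null_sets M"
    unfolding stuck_def using assms by (intro null_sets_UN running_sup_stuck_null) auto
  show "{\<omega>\<in>space M. c - x \<le> running_sup t \<omega> \<and> \<not> hit_above X x c \<omega> \<le> ereal t} \<subseteq> (\<Union>n. stuck n)"
  proof (rule subsetI, rule ccontr)
    fix \<omega> assume \<omega>: "\<omega> \<in> {\<omega>\<in>space M. c - x \<le> running_sup t \<omega> \<and> \<not> hit_above X x c \<omega> \<le> ereal t}"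
      "\<omega> \<notin> (\<Union>n. stuck n)"
    then have "hit_above X x c \<omega> \<le> ereal (t + 1 / real (Suc n))" for n
      using t by (intro hit_above_le_if_less_running_sup) (auto simp: stuck_def not_le)
    moreover have "(\<lambda>n. ereal (t + 1 / real (Suc n))) \<longlonglongrightarrow> ereal (t + 0)"
      by (intro tendsto_intros LIMSEQ_Suc[OF lim_1_over_n])
    ultimately have "hit_above X x c \<omega> \<le> ereal (t + 0)"
      by (intro LIMSEQ_le_const[of "\<lambda>n. ereal (t + 1 / real (Suc n))"]) blast+
    then show False using \<omega> by simp
  qed
qed

lemma hit_above_stopping_time: "stopping_time_ext F (hit_above X x c)"
  unfolding stopping_time_ext_def
proof (intro conjI ballI allI impI hit_above_nonneg)
  fix t :: real assume t: "t \<ge> 0"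
  define T where "T = {\<omega>\<in>space M. hit_above X x c \<omega> \<le> ereal t}"
  have "T \<in> sets (F t)"
  proof (cases "c \<le> x")
    case True
    then have "T = space (F t)"
      unfolding T_def space_F[OF t] using t X_0 by (auto simp: hit_above_le_iff intro!: exI[of _ 0])
    then show ?thesis by simp
  next
    case False
    define U where "U = {\<omega>\<in>space M. c - x \<le> running_sup t \<omega>}"
    have "U \<in> sets (F t)"
      using running_sup_adapted[OF t] unfolding U_def
      by (simp add: borel_measurable_iff_ge space_F[OF t])
    moreover have "U - T \<in> sets (F t)"
    proof -
      obtain N where "N \<in> null_sets M"
          "{\<omega>\<in>space M. c - x \<le> running_sup t \<omega> \<and> \<not> hit_above X x c \<omega> \<le> ereal t} \<subseteq> N"
        using running_sup_reaches_without_hit_null[OF _ t, of x c] False by auto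
      moreover have "U - T = {\<omega>\<in>space M. c - x \<le> running_sup t \<omega> \<and> \<not> hit_above X x c \<omega> \<le> ereal t}"
        by (auto simp: U_def T_def)
      ultimately show ?thesis using subset_null_set_in_F[OF t] by metis
    qed
    ultimately have "U - (U - T) \<in> sets (F t)" by (rule sets.Diff)
    moreover have "T \<subseteq> U"
      using X_le_running_sup by (fastforce simp: T_def U_def hit_above_le_iff)
    then have "U - (U - T) = T" by auto
    ultimately show ?thesis by simp
  qed
  then show "{\<omega>\<in>space (F t). hit_above X x c \<omega> \<le> ereal t} \<in> sets (F t)"
    unfolding T_def space_F[OF t] .
qed

end

section \<open>Discounted payoffs\<close>

lemma disc_payoff_mono:
  "(\<And>y. G y \<le> H y) \<Longrightarrow> disc_payoff r G X x \<rho> \<omega> \<le> disc_payoff r H X x \<rho> \<omega>"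
  by (simp add: disc_payoff_def)

lemma disc_payoff_diff:
  "disc_payoff r (\<lambda>y. G y - H y) X x \<rho> \<omega> = disc_payoff r G X x \<rho> \<omega> - disc_payoff r H X x \<rho> \<omega>"
  by (simp add: disc_payoff_def right_diff_distrib)

lemma disc_payoff_uminus:
  "disc_payoff r G (\<lambda>t \<omega>. - X t \<omega>) (- x) \<rho> \<omega> = disc_payoff r (\<lambda>y. G (- y)) X x \<rho> \<omega>"
  by (simp add: disc_payoff_def)

lemma disc_payoff_cong: "\<rho> \<omega> = \<sigma> \<omega> \<Longrightarrow> disc_payoff r G X x \<rho> \<omega> = disc_payoff r G X x \<sigma> \<omega>"
  by (simp add: disc_payoff_def)

context killed_levy
begin

lemma disc_payoff_measurable:
  assumes [measurable]: "G \<in> borel_measurable borel" and \<rho>: "stopping_time_ext F \<rho>"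
  shows "disc_payoff r G X x \<rho> \<in> borel_measurable M"
proof -
  have [measurable]: "\<rho> \<in> borel_measurable M" by (rule stopping_time_measurable[OF \<rho>])
  have [measurable]: "(\<lambda>\<omega>. X (real_of_ereal (\<rho> \<omega>)) \<omega>) \<in> borel_measurable M"
    using stopping_time_nonneg[OF \<rho>] by (intro X_random_time_measurable)
      (auto simp: real_of_ereal_pos)
  show ?thesis unfolding disc_payoff_def[abs_def] by measurable
qed

lemma ennreal_disc_payoff:
  "(\<And>y. H y \<ge> 0) \<Longrightarrow> ennreal (disc_payoff r H X x \<rho> \<omega>) = disc_value (\<lambda>y. ennreal (H y)) x \<rho> \<omega>"
  by (simp add: disc_value_def disc_payoff_def ennreal_mult)

definition payoff_bound :: "(real \<Rightarrow> real) \<Rightarrow> real \<Rightarrow> ennreal" where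
  "payoff_bound G x = (\<integral>\<^sup>+\<omega>. (SUP t\<in>{0..}. ennreal \<bar>exp (- r * t) * G (x + X t \<omega>)\<bar>) \<partial>M)"

lemma payoff_bound_finite: "dynkin_conditions M X r G \<Longrightarrow> payoff_bound G x < \<infinity>"
  by (simp add: dynkin_conditions_def payoff_bound_def)

lemma nn_integral_disc_payoff_le:
  assumes \<rho>: "stopping_time_ext F \<rho>"
  shows "(\<integral>\<^sup>+\<omega>. ennreal \<bar>disc_payoff r G X x \<rho> \<omega>\<bar> \<partial>M) \<le> payoff_bound G x"
  unfolding payoff_bound_def
proof (rule nn_integral_mono)
  fix \<omega> assume "\<omega> \<in> space M"
  then have "real_of_ereal (\<rho> \<omega>) \<ge> 0"
    using stopping_time_nonneg[OF \<rho>] by (simp add: real_of_ereal_pos)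
  then show "ennreal \<bar>disc_payoff r G X x \<rho> \<omega>\<bar>
      \<le> (SUP t\<in>{0..}. ennreal \<bar>exp (- r * t) * G (x + X t \<omega>)\<bar>)"
    unfolding disc_payoff_def by (intro SUP_upper2[of "real_of_ereal (\<rho> \<omega>)"]) auto
qed

lemma payoff_selection_integrable:
  assumes cond: "dynkin_conditions M X r G1" "dynkin_conditions M X r G2"
    and G: "G1 \<in> borel_measurable borel" "G2 \<in> borel_measurable borel"
    and \<tau>: "stopping_time_ext F \<tau>" and \<sigma>: "stopping_time_ext F \<sigma>" and P: "{\<omega>\<in>space M. P \<omega>} \<in> sets M"
  shows "integrable M (\<lambda>\<omega>. if P \<omega> then disc_payoff r G1 X x \<tau> \<omega> else disc_payoff r G2 X x \<sigma> \<omega>)"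
    and "\<bar>\<integral>\<omega>. (if P \<omega> then disc_payoff r G1 X x \<tau> \<omega> else disc_payoff r G2 X x \<sigma> \<omega>) \<partial>M\<bar>
      \<le> enn2real (payoff_bound G1 x + payoff_bound G2 x)"
proof -
  let ?d1 = "disc_payoff r G1 X x \<tau>" and ?d2 = "disc_payoff r G2 X x \<sigma>"
  let ?f = "\<lambda>\<omega>. if P \<omega> then ?d1 \<omega> else ?d2 \<omega>"
  have [measurable]: "?d1 \<in> borel_measurable M" "?d2 \<in> borel_measurable M"
    using G \<tau> \<sigma> by (auto intro: disc_payoff_measurable)
  have meas: "?f \<in> borel_measurable M" using P by (intro measurable_If) auto
  have "(\<integral>\<^sup>+\<omega>. ennreal (norm (?f \<omega>)) \<partial>M) \<le> (\<integral>\<^sup>+\<omega>. ennreal \<bar>?d1 \<omega>\<bar> + ennreal \<bar>?d2 \<omega>\<bar> \<partial>M)"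
    by (intro nn_integral_mono) auto
  also have "\<dots> = (\<integral>\<^sup>+\<omega>. ennreal \<bar>?d1 \<omega>\<bar> \<partial>M) + (\<integral>\<^sup>+\<omega>. ennreal \<bar>?d2 \<omega>\<bar> \<partial>M)"
    by (intro nn_integral_add) auto
  also have "\<dots> \<le> payoff_bound G1 x + payoff_bound G2 x"
    by (intro add_mono nn_integral_disc_payoff_le \<tau> \<sigma>)
  finally have bound: "(\<integral>\<^sup>+\<omega>. ennreal (norm (?f \<omega>)) \<partial>M) \<le> payoff_bound G1 x + payoff_bound G2 x" .
  have finite: "payoff_bound G1 x + payoff_bound G2 x < \<infinity>"
    using payoff_bound_finite[OF cond(1)] payoff_bound_finite[OF cond(2)] by simp
  show "integrable M ?f"
    unfolding integrable_iff_bounded using meas le_less_trans[OF bound finite] by simp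
  have "\<bar>\<integral>\<omega>. ?f \<omega> \<partial>M\<bar> \<le> (\<integral>\<omega>. norm (?f \<omega>) \<partial>M)"
    using integral_norm_bound[of M ?f] by simp
  also have "\<dots> = enn2real (\<integral>\<^sup>+\<omega>. ennreal (norm (?f \<omega>)) \<partial>M)"
    using meas by (intro integral_eq_nn_integral) auto
  also have "\<dots> \<le> enn2real (payoff_bound G1 x + payoff_bound G2 x)"
    using bound finite by (intro enn2real_mono) auto
  finally show "\<bar>\<integral>\<omega>. ?f \<omega> \<partial>M\<bar> \<le> enn2real (payoff_bound G1 x + payoff_bound G2 x)" .
qed

end

context exp_sup_levy
begin

lemma integral_disc_payoff_hinge_mean:
  fixes a k c :: real
  assumes ak: "a > 0" "k \<ge> 0" "a * k \<le> 1" and \<rho>: "stopping_time_ext F \<rho>"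
  defines "H \<equiv> hinge_mean a b q k c"
  shows "integrable M (disc_payoff r H X x \<rho>)"
    and "(\<integral>\<omega>. disc_payoff r H X x \<rho> \<omega> \<partial>M) \<le> H x"
    and "(\<And>\<omega>. \<omega> \<in> space M \<Longrightarrow> \<rho> \<omega> \<le> hit_above X x c \<omega>) \<Longrightarrow> (\<integral>\<omega>. disc_payoff r H X x \<rho> \<omega> \<partial>M) = H x"
proof -
  have H_nonneg: "H y \<ge> 0" for y unfolding H_def using b_pos q by (intro hinge_mean_nonneg ak) auto
  have sup_value_eq: "sup_value (hinge a k c) = (\<lambda>y. ennreal (H y))"
    unfolding H_def by (rule ext) (rule sup_value_hinge[OF ak])
  note sampling = optional_sampling[OF hinge_mono[OF ak] hinge_continuous \<rho>, of c x,
      unfolded sup_value_eq ennreal_disc_payoff[of H, OF H_nonneg, symmetric]]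
  have meas: "disc_payoff r H X x \<rho> \<in> borel_measurable M"
    unfolding H_def by (rule disc_payoff_measurable[OF hinge_mean_measurable \<rho>])
  have nonneg: "disc_payoff r H X x \<rho> \<omega> \<ge> 0" for \<omega>
    using H_nonneg by (simp add: disc_payoff_def)
  show "integrable M (disc_payoff r H X x \<rho>)"
    using meas nonneg sampling(1) by (intro integrableI_nonneg) (auto intro: le_less_trans)
  have integral: "(\<integral>\<omega>. disc_payoff r H X x \<rho> \<omega> \<partial>M)
      = enn2real (\<integral>\<^sup>+\<omega>. ennreal (disc_payoff r H X x \<rho> \<omega>) \<partial>M)"
    using meas nonneg by (intro integral_eq_nn_integral) auto
  show "(\<integral>\<omega>. disc_payoff r H X x \<rho> \<omega> \<partial>M) \<le> H x"
    unfolding integral using H_nonneg sampling(1) by (intro enn2real_leI)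
  assume before: "\<And>\<omega>. \<omega> \<in> space M \<Longrightarrow> \<rho> \<omega> \<le> hit_above X x c \<omega>"
  have "vanishes_before (hinge a k c) x \<rho>"
    unfolding vanishes_before_def
  proof (intro ballI allI impI)
    fix \<omega> t assume \<omega>: "\<omega> \<in> space M" and t: "t \<ge> 0" "ereal t < \<rho> \<omega>"
    have "ereal t < hit_above X x c \<omega>" using t(2) before[OF \<omega>] by (rule less_le_trans)
    then show "hinge a k c (x + X t \<omega>) = 0"
      using less_before_hit_above[OF \<omega> t(1)] by (intro hinge_eq_0) (rule less_imp_le)
  qed
  then show "(\<integral>\<omega>. disc_payoff r H X x \<rho> \<omega> \<partial>M) = H x"
    unfolding integral using sampling(2) H_nonneg by simp
qed

end

section \<open>The value function\<close>

context gap_equation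
begin

definition game_value :: "real \<Rightarrow> real \<Rightarrow> real" where
  "game_value u x = (if x \<le> xI u then x + \<delta>
   else if x < xS u then AI u * exp (- rI * (x - xS u)) + AS u * exp (rS * (x - xI u))
   else x - \<delta>)"

lemma AI_neg: "u > 0 \<Longrightarrow> AI u < 0"
  using mirror.AS_pos by simp

lemma hinge_mean_xS:
  assumes u: "u > 0" and gap: "xS u - xI u = u"
  shows "hinge_mean rI rS \<pi>S (FS * - AI u) (xS u) y =
    (if y < xS u then AS u * exp (rS * (y - xI u)) else y - \<delta> - AI u * exp (- rI * (y - xS u)))"
proof -
  define k where "k = FS * - AI u"
  have "rI + rS \<noteq> 0" using rI_pos rS_pos by simp
  then have rI_k: "(1 - \<pi>S) * (rI * k) / (rI + rS) = - GS * AI u"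
    by (simp add: k_def FS_def mirror.GI_eq ac_simps)
  show ?thesis
  proof (cases "y < xS u")
    case True
    define E where "E = exp (- rS * (xS u - y))"
    have "hinge_mean rI rS \<pi>S k (xS u) y = E * (ES - (1 - \<pi>S) * (rI * k) / (rI + rS))"
      using True
      by (simp add: hinge_mean_def Let_def hinge_eq_0 max_absorb1 ES_def E_def algebra_simps)
    also have "\<dots> = AS u * (E * exp (rS * u))"
      unfolding rI_k using AS_exp[OF u] by (simp add: algebra_simps)
    also have "E * exp (rS * u) = exp (rS * (y - xI u))"
      unfolding E_def exp_add[symmetric] using gap by (simp add: algebra_simps)
    finally show ?thesis using True by (simp add: k_def)
  next
    case False
    define E where "E = exp (- rI * (y - xS u))"
    have "hinge_mean rI rS \<pi>S k (xS u) y
        = y - xS u - k + ES + E * (k - (1 - \<pi>S) * (rI * k) / (rI + rS))"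
      using False
      by (simp add: hinge_mean_def Let_def hinge_def max_absorb2 ES_def E_def algebra_simps)
    also have "\<dots> = y - \<delta> - AI u * E"
      unfolding rI_k by (simp add: xS_def k_def mirror.FI_eq algebra_simps)
    finally show ?thesis using False by (simp add: k_def E_def)
  qed
qed

end

context gap_equation
begin

lemma game_value_eq:
  assumes u: "u > 0" and gap: "xS u - xI u = u"
  shows "game_value u y = hinge_mean rI rS \<pi>S (FS * - AI u) (xS u) y
    - hinge_mean rS rI \<pi>I (FI * AS u) (- xI u) (- y)"
  using hinge_mean_xS[OF assms, of y] mirror.hinge_mean_xS[OF u, of "- y"] gap u
  by (auto simp: game_value_def algebra_simps)

lemma slope_xS_le_1:
  assumes u: "u > 0"
  shows "- rI * AI u + rS * (AS u * exp (rS * u)) \<le> 1"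
proof -
  have "rI - rS * GS = \<pi>S * (rI * FS)" by (rule mirror.rS_minus_rI_GI)
  then have "- rI * AI u + rS * (AS u * exp (rS * u)) = rS * ES + \<pi>S * (rI * (FS * - AI u))"
    unfolding AS_exp[OF u] by algebra
  also have "\<dots> \<le> (1 - \<pi>S) + \<pi>S * 1"
    using mirror.rS_FI_AS_less[OF u] piS rS_pos by (intro add_mono mult_left_mono)
      (auto simp: ES_def)
  finally show ?thesis by simp
qed

end

context gap_equation
begin

lemma slope_le_1:
  assumes u: "u > 0" and gap: "xS u - xI u = u" and y: "xI u \<le> y" "y \<le> xS u"
  shows "- rI * AI u * exp (- rI * (y - xS u)) + rS * AS u * exp (rS * (y - xI u)) \<le> 1"
proof -
  let ?f = "\<lambda>y. - rI * AI u * exp (- rI * (y - xS u)) + rS * AS u * exp (rS * (y - xI u))"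
  have convex: "convex_on {xI u..xS u} ?f"
  proof (rule f''_ge0_imp_convex)
    fix z
    show "(?f has_real_derivative rI\<^sup>2 * AI u * exp (- rI * (z - xS u)) + rS\<^sup>2 * AS u * exp (rS * (z - xI u))) (at z)"
      by (auto intro!: derivative_eq_intros simp: power2_eq_square)
    show "((\<lambda>z. rI\<^sup>2 * AI u * exp (- rI * (z - xS u)) + rS\<^sup>2 * AS u * exp (rS * (z - xI u))) has_real_derivative
        rI ^ 3 * - AI u * exp (- rI * (z - xS u)) + rS ^ 3 * AS u * exp (rS * (z - xI u))) (at z)"
      by (auto intro!: derivative_eq_intros simp: power2_eq_square power3_eq_cube)
    show "0 \<le> rI ^ 3 * - AI u * exp (- rI * (z - xS u)) + rS ^ 3 * AS u * exp (rS * (z - xI u))"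
      using AI_neg[OF u] AS_pos[OF u] rI_pos rS_pos
      by (intro add_nonneg_nonneg mult_nonneg_nonneg) auto
  qed simp
  have "?f y \<le> max (?f (xI u)) (?f (xS u))"
    using y by (intro convex_on_le_max[OF convex]) simp
  moreover have "?f (xS u) \<le> 1"
    using slope_xS_le_1[OF u] gap by simp
  moreover have "?f (xI u) \<le> 1"
  proof -
    have "- rI * (xI u - xS u) = rI * u" using gap by (simp add: algebra_simps)
    then show ?thesis using mirror.slope_xS_le_1[OF u] by (simp add: algebra_simps)
  qed
  ultimately show ?thesis by simp
qed

lemma game_value_bounds:
  assumes u: "u > 0" and gap: "xS u - xI u = u"
  shows "y - \<delta> \<le> game_value u y" "game_value u y \<le> y + \<delta>"
proof -
  let ?f = "\<lambda>y. AI u * exp (- rI * (y - xS u)) + AS u * exp (rS * (y - xI u)) - y"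
  have decreasing: "?f z \<le> ?f y" if "xI u \<le> y" "y \<le> z" "z \<le> xS u" for y z
  proof (rule DERIV_nonpos_imp_nonincreasing[OF that(2)])
    fix v assume "y \<le> v" "v \<le> z"
    then have "- rI * AI u * exp (- rI * (v - xS u)) + rS * AS u * exp (rS * (v - xI u)) - 1 \<le> 0"
      using slope_le_1[OF u gap, of v] that by linarith
    moreover have "(?f has_real_derivative
        - rI * AI u * exp (- rI * (v - xS u)) + rS * AS u * exp (rS * (v - xI u)) - 1) (at v)"
      by (auto intro!: derivative_eq_intros)
    ultimately show "\<exists>d. (?f has_real_derivative d) (at v) \<and> d \<le> 0" by blast
  qed
  have "?f (xS u) = - \<delta>"
    using AS_exp[OF u] gap by (simp add: xS_def mirror.FI_eq algebra_simps)
  moreover have "?f (xI u) = \<delta>"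
  proof -
    have "- rI * (xI u - xS u) = rI * u" using gap by (simp add: algebra_simps)
    then show ?thesis using mirror.AS_exp[OF u] by (simp add: xI_def FI_eq algebra_simps)
  qed
  ultimately have "- \<delta> \<le> ?f y \<and> ?f y \<le> \<delta>" if "xI u \<le> y" "y \<le> xS u"
    using decreasing[of "xI u" y] decreasing[of y "xS u"] that by auto
  then show "y - \<delta> \<le> game_value u y" "game_value u y \<le> y + \<delta>"
    using delta_pos unfolding game_value_def by force+
qed

end

section \<open>Reflection\<close>

lemma vimage_uminus_sets:
  assumes "B \<in> sets borel"
  shows "\<exists>B'. (\<lambda>\<omega>. - Y \<omega>) -` B \<inter> A = Y -` B' \<inter> A \<and> B' \<in> sets (borel :: real measure)"
proof (intro exI[of _ "uminus -` B"] conjI)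
  show "uminus -` B \<in> sets (borel :: real measure)"
    using measurable_sets[of uminus borel borel, OF _ assms] by simp
qed auto

lemma cadlag_uminus:
  assumes "cadlag f"
  shows "cadlag (\<lambda>t. - f t)"
  unfolding cadlag_def
proof (intro allI impI conjI)
  fix t :: real assume t: "t \<ge> 0"
  then show "continuous (at_right t) (\<lambda>s. - f s)"
    using assms by (intro continuous_minus) (simp add: cadlag_def)
  assume "t > 0"
  then obtain l where "(f \<longlongrightarrow> l) (at_left t)" using assms t unfolding cadlag_def by blast
  then show "\<exists>l. ((\<lambda>s. - f s) \<longlongrightarrow> l) (at_left t)" by (blast intro: tendsto_minus)
qed

lemma (in levy) levy_uminus: "levy M F (\<lambda>t \<omega>. - X t \<omega>)"
proof
  have indep: "indep_set (sets (F t)) {(\<lambda>\<omega>. - X (t + s) \<omega> - - X t \<omega>) -` B \<inter> space M | B. B \<in> sets borel}"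
    if st: "0 \<le> s" "0 \<le> t" for s t
  proof (rule indep_set_mono[OF indep_increment[OF st] order_refl], safe)
    fix B :: "real set" assume "B \<in> sets borel"
    from vimage_uminus_sets[OF this, of "\<lambda>\<omega>. X (t + s) \<omega> - X t \<omega>" "space M"]
    show "\<exists>B'. (\<lambda>\<omega>. - X (t + s) \<omega> - - X t \<omega>) -` B \<inter> space M
        = (\<lambda>\<omega>. X (t + s) \<omega> - X t \<omega>) -` B' \<inter> space M \<and> B' \<in> sets borel" by simp
  qed
  have distr: "distr M borel (\<lambda>\<omega>. - X (t + s) \<omega> - - X t \<omega>) = distr M borel (\<lambda>\<omega>. - X s \<omega>)"
    if st: "0 \<le> s" "0 \<le> t" for s t
  proof -
    have "distr M borel (\<lambda>\<omega>. - X (t + s) \<omega> - - X t \<omega>)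
        = distr (distr M borel (\<lambda>\<omega>. X (t + s) \<omega> - X t \<omega>)) borel uminus"
      using st by (subst distr_distr) (auto simp: o_def intro!: distr_cong)
    also have "\<dots> = distr M borel (\<lambda>\<omega>. - X s \<omega>)"
      unfolding distr_increment[OF st] using st by (subst distr_distr) (auto simp: o_def)
    finally show ?thesis .
  qed
  show "levy_process M F (\<lambda>t \<omega>. - X t \<omega>)"
    unfolding levy_process_def
    using usual X_0 X_adapted cadlag_uminus[OF cadlag_X, unfolded cadlag_def] indep distr
    by (intro conjI ballI allI impI) (simp_all only: borel_measurable_uminus minus_zero)
qed

lemma (in killed_levy) killed_levy_uminus: "killed_levy M F (\<lambda>t \<omega>. - X t \<omega>) er r"
proof (intro killed_levy.intro levy_uminus killed_levy_axioms.intro r_pos er_exp)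
  have "sigma_sets (space M) {(\<lambda>\<omega>. - X t \<omega>) -` B \<inter> space M | t B. 0 \<le> t \<and> B \<in> sets borel}
      \<subseteq> sigma_sets (space M) {X t -` B \<inter> space M | t B. 0 \<le> t \<and> B \<in> sets borel}"
  proof (rule sigma_sets_subseteq, safe)
    fix t :: real and B :: "real set" assume "0 \<le> t" "B \<in> sets borel"
    then show "\<exists>t' B'. (\<lambda>\<omega>. - X t \<omega>) -` B \<inter> space M = X t' -` B' \<inter> space M
        \<and> 0 \<le> t' \<and> B' \<in> sets borel"
      using vimage_uminus_sets[of B "X t" "space M"] by blast
  qed
  then show "indep_set {er -` B \<inter> space M | B. B \<in> sets borel}
      (sigma_sets (space M) {(\<lambda>\<omega>. - X t \<omega>) -` B \<inter> space M | t B. 0 \<le> t \<and> B \<in> sets borel})"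
    by (rule indep_set_mono[OF er_indep order_refl])
qed

section \<open>The game\<close>

locale two_sided_levy =
  S: exp_sup_levy M F X er r q b + I: exp_sup_levy M F "\<lambda>t \<omega>. - X t \<omega>" er r p a
  for M :: "'a measure" and F X er r q b p a
begin

lemma two_sided_levy_uminus: "two_sided_levy M F (\<lambda>t \<omega>. - X t \<omega>) er r p a q b"
  unfolding two_sided_levy_def using S.exp_sup_levy_axioms I.exp_sup_levy_axioms by simp

lemma hit_below_stopping_time: "stopping_time_ext F (hit_below X x c)"
  unfolding hit_below_eq_hit_above_uminus by (rule I.hit_above_stopping_time)

lemma hit_below_attained:
  assumes "\<omega> \<in> space M" "hit_below X x c \<omega> = ereal t"
  shows "x + X t \<omega> \<le> c"
  using I.hit_above_attained[OF assms[unfolded hit_below_eq_hit_above_uminus]] by simp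

text \<open>The rule \<open>P\<close> for breaking ties is arbitrary, since reflection reverses the convention of the
  game.\<close>

lemma payoff_le_stopped_value:
  assumes V: "\<And>y. G1 y \<le> V y" "\<And>y. y \<le> c \<Longrightarrow> V y = G2 y" and \<omega>: "\<omega> \<in> space M"
    and P: "P \<omega> \<Longrightarrow> \<tau> \<omega> \<le> hit_below X x c \<omega>" "\<not> P \<omega> \<Longrightarrow> hit_below X x c \<omega> \<le> \<tau> \<omega>"
  shows "(if P \<omega> then disc_payoff r G1 X x \<tau> \<omega> else disc_payoff r G2 X x (hit_below X x c) \<omega>)
    \<le> disc_payoff r V X x (\<lambda>\<omega>. min (\<tau> \<omega>) (hit_below X x c \<omega>)) \<omega>"
proof (cases "P \<omega>")
  case True
  have "disc_payoff r G1 X x \<tau> \<omega> \<le> disc_payoff r V X x \<tau> \<omega>" by (rule disc_payoff_mono[OF V(1)])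
  also have "\<dots> = disc_payoff r V X x (\<lambda>\<omega>. min (\<tau> \<omega>) (hit_below X x c \<omega>)) \<omega>"
    using P(1)[OF True] by (intro disc_payoff_cong) (simp add: min_absorb1)
  finally show ?thesis using True by simp
next
  case False
  have "disc_payoff r G2 X x (hit_below X x c) \<omega> = disc_payoff r V X x (hit_below X x c) \<omega>"
  proof (cases "hit_below X x c \<omega>")
    case (real t)
    then show ?thesis using V(2)[OF hit_below_attained[OF \<omega> real]] by (simp add: disc_payoff_def)
  next
    case MInf
    then show ?thesis using S.stopping_time_nonneg[OF hit_below_stopping_time \<omega>, of x c] by simp
  qed (simp add: disc_payoff_def)
  also have "\<dots> = disc_payoff r V X x (\<lambda>\<omega>. min (\<tau> \<omega>) (hit_below X x c \<omega>)) \<omega>"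
    using P(2)[OF False] by (intro disc_payoff_cong) (simp add: min_absorb2)
  finally show ?thesis using False by simp
qed

lemma integral_payoff_le:
  assumes kS: "kS \<ge> 0" "a * kS \<le> 1" and kI: "kI \<ge> 0" "b * kI \<le> 1"
    and V: "\<And>y. V y = hinge_mean a b q kS cS y - hinge_mean b a p kI (- cI) (- y)"
    and V_bounds: "\<And>y. G1 y \<le> V y" "\<And>y. y \<le> cI \<Longrightarrow> V y = G2 y" and \<tau>: "stopping_time_ext F \<tau>"
    and P: "\<And>\<omega>. P \<omega> \<Longrightarrow> \<tau> \<omega> \<le> hit_below X x cI \<omega>" "\<And>\<omega>. \<not> P \<omega> \<Longrightarrow> hit_below X x cI \<omega> \<le> \<tau> \<omega>"
    and int: "integrable M (\<lambda>\<omega>. if P \<omega> then disc_payoff r G1 X x \<tau> \<omega>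
      else disc_payoff r G2 X x (hit_below X x cI) \<omega>)"
  shows "(\<integral>\<omega>. (if P \<omega> then disc_payoff r G1 X x \<tau> \<omega> else disc_payoff r G2 X x (hit_below X x cI) \<omega>) \<partial>M)
    \<le> V x"
proof -
  define \<rho> where "\<rho> \<omega> = min (\<tau> \<omega>) (hit_below X x cI \<omega>)" for \<omega>
  have \<rho>: "stopping_time_ext F \<rho>"
    unfolding \<rho>_def by (rule S.stopping_time_min[OF \<tau> hit_below_stopping_time])
  define H where "H = hinge_mean a b q kS cS"
  define J where "J y = hinge_mean b a p kI (- cI) (- y)" for y
  have V_eq: "V = (\<lambda>y. H y - J y)" using V by (auto simp: H_def J_def)
  have H: "integrable M (disc_payoff r H X x \<rho>)" "(\<integral>\<omega>. disc_payoff r H X x \<rho> \<omega> \<partial>M) \<le> H x"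
    unfolding H_def by (rule S.integral_disc_payoff_hinge_mean[OF I.b_pos kS \<rho>])+
  have J_reflected: "disc_payoff r J X x \<rho>
      = disc_payoff r (hinge_mean b a p kI (- cI)) (\<lambda>t \<omega>. - X t \<omega>) (- x) \<rho>"
    by (rule ext) (simp add: J_def[abs_def] disc_payoff_uminus)
  have J: "integrable M (disc_payoff r J X x \<rho>)" "(\<integral>\<omega>. disc_payoff r J X x \<rho> \<omega> \<partial>M) = J x"
    unfolding J_reflected unfolding J_def
    using I.integral_disc_payoff_hinge_mean(1,3)[OF S.b_pos kI \<rho>]
    by (auto simp: \<rho>_def hit_below_eq_hit_above_uminus)
  have "(\<integral>\<omega>. (if P \<omega> then disc_payoff r G1 X x \<tau> \<omega> else disc_payoff r G2 X x (hit_below X x cI) \<omega>) \<partial>M)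
      \<le> (\<integral>\<omega>. disc_payoff r V X x \<rho> \<omega> \<partial>M)"
  proof (rule integral_mono[OF int])
    show "integrable M (disc_payoff r V X x \<rho>)"
      unfolding V_eq disc_payoff_diff[abs_def]
      by (rule Bochner_Integration.integrable_diff[OF H(1) J(1)])
    show "(if P \<omega> then disc_payoff r G1 X x \<tau> \<omega> else disc_payoff r G2 X x (hit_below X x cI) \<omega>)
        \<le> disc_payoff r V X x \<rho> \<omega>" if "\<omega> \<in> space M" for \<omega>
      unfolding \<rho>_def using that V_bounds P by (intro payoff_le_stopped_value)
  qed
  also have "\<dots> = (\<integral>\<omega>. disc_payoff r H X x \<rho> \<omega> \<partial>M) - (\<integral>\<omega>. disc_payoff r J X x \<rho> \<omega> \<partial>M)"
    unfolding V_eq disc_payoff_diff by (rule Bochner_Integration.integral_diff[OF H(1) J(1)])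
  also have "\<dots> \<le> V x" using H(2) J(2) by (simp add: V_eq)
  finally show ?thesis .
qed

end

locale exponential_dynkin_game =
  gap_equation rI rS \<pi>I \<pi>S \<delta> + two_sided_levy M F X er r \<pi>S rS \<pi>I rI
  for rI rS \<pi>I \<pi>S \<delta> :: real and M :: "'a measure" and F X er r +
  assumes conditions: "dynkin_conditions M X r (\<lambda>y. y - \<delta>)" "dynkin_conditions M X r (\<lambda>y. y + \<delta>)"
begin

lemma gap_equation_iff: "u - 2 * \<delta> - EI - ES
      = (- EI * FS * exp (rS * u) - ES * FI * exp (rI * u) + 2 * ES * FS * GI)
        / (exp ((rI + rS) * u) - GI * GS)
    \<longleftrightarrow> xS u - xI u = u"
  by (auto simp: gap_eq)

abbreviation game_payoff :: "real \<Rightarrow> ('a \<Rightarrow> ereal) \<Rightarrow> ('a \<Rightarrow> ereal) \<Rightarrow> real" where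
  "game_payoff \<equiv> dynkin_M M X r (\<lambda>y. y - \<delta>) (\<lambda>y. y + \<delta>)"

lemma payoff_integrable:
  assumes \<sigma>: "stopping_time_ext F \<sigma>" and \<tau>: "stopping_time_ext F \<tau>"
  shows "integrable M (\<lambda>\<omega>. if \<tau> \<omega> \<le> \<sigma> \<omega> then disc_payoff r (\<lambda>y. y - \<delta>) X x \<tau> \<omega>
      else disc_payoff r (\<lambda>y. y + \<delta>) X x \<sigma> \<omega>)"
    and "\<bar>game_payoff x \<sigma> \<tau>\<bar>
        \<le> enn2real (S.payoff_bound (\<lambda>y. y - \<delta>) x + S.payoff_bound (\<lambda>y. y + \<delta>) x)"
proof -
  note [measurable] = S.stopping_time_measurable[OF \<sigma>] S.stopping_time_measurable[OF \<tau>]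
  have "{\<omega>\<in>space M. \<tau> \<omega> \<le> \<sigma> \<omega>} \<in> sets M" by measurable
  from S.payoff_selection_integrable[OF conditions _ _ \<tau> \<sigma> this, of x]
  show "integrable M (\<lambda>\<omega>. if \<tau> \<omega> \<le> \<sigma> \<omega> then disc_payoff r (\<lambda>y. y - \<delta>) X x \<tau> \<omega>
      else disc_payoff r (\<lambda>y. y + \<delta>) X x \<sigma> \<omega>)"
    "\<bar>game_payoff x \<sigma> \<tau>\<bar> \<le> enn2real (S.payoff_bound (\<lambda>y. y - \<delta>) x + S.payoff_bound (\<lambda>y. y + \<delta>) x)"
    by (simp_all add: dynkin_M_def)
qed

context
  fixes u :: real
  assumes u: "u > 0" and gap: "xS u - xI u = u"
begin

lemma hinge_coefficients:
  "FS * - AI u \<ge> 0" "rI * (FS * - AI u) \<le> 1" "FI * AS u \<ge> 0" "rS * (FI * AS u) \<le> 1"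
  using mult_pos_pos[OF FI_pos AS_pos[OF u]] mult_pos_pos[OF mirror.FI_pos mirror.AS_pos[OF u]]
    rS_FI_AS_less[OF u] mirror.rS_FI_AS_less[OF u] by simp_all

lemma game_value_below: "y \<le> xI u \<Longrightarrow> game_value u y = y + \<delta>"
  and game_value_above: "xS u \<le> y \<Longrightarrow> game_value u y = y - \<delta>"
  using u gap by (simp_all add: game_value_def)

lemma game_payoff_hit_below_le:
  assumes \<tau>: "stopping_time_ext F \<tau>"
  shows "game_payoff x (hit_below X x (xI u)) \<tau> \<le> game_value u x"
  unfolding dynkin_M_def
  by (rule integral_payoff_le[OF hinge_coefficients game_value_eq[OF u gap]
        game_value_bounds(1)[OF u gap] game_value_below \<tau> _ _ payoff_integrable(1)[OF hit_below_stopping_time \<tau>]])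
    auto

lemma game_payoff_hit_above_ge:
  assumes \<sigma>: "stopping_time_ext F \<sigma>"
  shows "game_value u x \<le> game_payoff x \<sigma> (hit_above X x (xS u))"
proof -
  interpret reflected: two_sided_levy M F "\<lambda>t \<omega>. - X t \<omega>" er r \<pi>I rI \<pi>S rS
    by (rule two_sided_levy_uminus)
  let ?\<tau> = "hit_above X x (xS u)"
  let ?payoff = "\<lambda>\<omega>. if ?\<tau> \<omega> \<le> \<sigma> \<omega> then disc_payoff r (\<lambda>y. y - \<delta>) X x ?\<tau> \<omega>
    else disc_payoff r (\<lambda>y. y + \<delta>) X x \<sigma> \<omega>"
  let ?reflected = "\<lambda>\<omega>. if \<not> ?\<tau> \<omega> \<le> \<sigma> \<omega> then disc_payoff r (\<lambda>y. y - \<delta>) (\<lambda>t \<omega>. - X t \<omega>) (- x) \<sigma> \<omega>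
    else disc_payoff r (\<lambda>y. y + \<delta>) (\<lambda>t \<omega>. - X t \<omega>) (- x) (hit_below (\<lambda>t \<omega>. - X t \<omega>) (- x) (- xS u)) \<omega>"
  have \<tau>_eq: "hit_below (\<lambda>t \<omega>. - X t \<omega>) (- x) (- xS u) = ?\<tau>"
    by (simp add: hit_below_eq_hit_above_uminus)
  have reflected_eq: "?reflected = (\<lambda>\<omega>. - ?payoff \<omega>)"
    unfolding \<tau>_eq disc_payoff_uminus by (auto simp: fun_eq_iff disc_payoff_def algebra_simps)
  have "integrable M ?payoff" by (rule payoff_integrable(1)[OF \<sigma> S.hit_above_stopping_time])
  then have int: "integrable M ?reflected" unfolding reflected_eq by (rule integrable_minus)
  have "(\<integral>\<omega>. ?reflected \<omega> \<partial>M) \<le> - game_value u (- (- x))"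
  proof (rule reflected.integral_payoff_le[OF hinge_coefficients(3,4,1,2) _ _ _ \<sigma> _ _ int])
    show "- game_value u (- y) = hinge_mean rS rI \<pi>I (FI * AS u) (- xI u) y
        - hinge_mean rI rS \<pi>S (FS * - AI u) (- (- xS u)) (- y)" for y
      by (simp add: game_value_eq[OF u gap])
    show "y - \<delta> \<le> - game_value u (- y)" for y
      using game_value_bounds(2)[OF u gap, of "- y"] by simp
    show "- game_value u (- y) = y + \<delta>" if "y \<le> - xS u" for y
      using game_value_above[of "- y"] that by simp
  qed (simp_all add: \<tau>_eq)
  then show ?thesis by (simp add: reflected_eq dynkin_M_def)
qed

lemma game_value_saddle_point:
  defines "ST \<equiv> {\<tau>. stopping_time_ext F \<tau>}"
  shows "hit_below X x (xI u) \<in> ST" "hit_above X x (xS u) \<in> ST"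
    "game_value u x = (INF \<sigma>\<in>ST. SUP \<tau>\<in>ST. game_payoff x \<sigma> \<tau>)"
    "game_value u x = (SUP \<tau>\<in>ST. INF \<sigma>\<in>ST. game_payoff x \<sigma> \<tau>)"
    "game_value u x = game_payoff x (hit_below X x (xI u)) (hit_above X x (xS u))"
proof -
  let ?C = "enn2real (S.payoff_bound (\<lambda>y. y - \<delta>) x + S.payoff_bound (\<lambda>y. y + \<delta>) x)"
  show \<sigma>: "hit_below X x (xI u) \<in> ST" and \<tau>: "hit_above X x (xS u) \<in> ST"
    by (simp_all add: ST_def hit_below_stopping_time S.hit_above_stopping_time)
  have bounds: "- ?C \<le> game_payoff x \<sigma> \<tau>" "game_payoff x \<sigma> \<tau> \<le> ?C" if "\<sigma> \<in> ST" "\<tau> \<in> ST" for \<sigma> \<tau>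
    using payoff_integrable(2)[of \<sigma> \<tau> x] that by (auto simp: ST_def abs_le_iff)
  have bdd: "bdd_above (game_payoff x \<rho> ` ST)" "bdd_below ((\<lambda>\<sigma>. game_payoff x \<sigma> \<rho>) ` ST)"
    if "\<rho> \<in> ST" for \<rho>
    using bounds that by (auto intro!: bdd_aboveI2[where M="?C"] bdd_belowI2[where m="- ?C"])
  have upper: "game_payoff x (hit_below X x (xI u)) \<rho> \<le> game_value u x"
    and lower: "game_value u x \<le> game_payoff x \<rho> (hit_above X x (xS u))" if "\<rho> \<in> ST" for \<rho>
    using that game_payoff_hit_below_le game_payoff_hit_above_ge by (auto simp: ST_def)
  show "game_value u x = (INF \<sigma>\<in>ST. SUP \<tau>\<in>ST. game_payoff x \<sigma> \<tau>)"
    "game_value u x = (SUP \<tau>\<in>ST. INF \<sigma>\<in>ST. game_payoff x \<sigma> \<tau>)"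
    "game_value u x = game_payoff x (hit_below X x (xI u)) (hit_above X x (xS u))"
    by (rule saddle_point_minimax[OF \<sigma> \<tau> upper lower bdd]; assumption)+
qed

end

end

theorem theorem2:
  fixes M :: "'a measure" and F :: "real \<Rightarrow> 'a measure" and X :: "real \<Rightarrow> 'a \<Rightarrow> real"
    and er :: "'a \<Rightarrow> real"
    and r \<delta> \<pi>I \<pi>S rI rS :: real
  assumes levy: "levy_process M F X"
    and r_pos: "r > 0" and delta_pos: "\<delta> > 0"
    and cond1: "dynkin_conditions M X r (\<lambda>y. y - \<delta>)"
    and cond2: "dynkin_conditions M X r (\<lambda>y. y + \<delta>)"
    and rI_pos: "rI > 0" and rS_pos: "rS > 0"
    and root_S: "\<forall>t\<ge>0. integrable M (\<lambda>\<omega>. exp (rS * X t \<omega>))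
                     \<and> (\<integral>\<omega>. exp (rS * X t \<omega>) \<partial>M) = exp (t * r)"
    and root_I: "\<forall>t\<ge>0. integrable M (\<lambda>\<omega>. exp ((- rI) * X t \<omega>))
                     \<and> (\<integral>\<omega>. exp ((- rI) * X t \<omega>) \<partial>M) = exp (t * r)"
    and er_exp: "distributed M lborel er (exponential_density r)"
    and er_indep: "prob_space.indep_set M
        {er -` B \<inter> space M | B. B \<in> sets borel}
        (sigma_sets (space M) {X t -` B \<inter> space M | t B. 0 \<le> t \<and> B \<in> sets borel})"
    and piI: "0 \<le> \<pi>I" "\<pi>I < 1" and piS: "0 \<le> \<pi>S" "\<pi>S < 1"
    and law_I: "\<forall>y\<ge>0. measure M {\<omega>\<in>space M. - Inf ((\<lambda>t. X t \<omega>) ` {0..er \<omega>}) > y}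
                       = (1 - \<pi>I) * exp (- rI * y)"
    and law_S: "\<forall>y\<ge>0. measure M {\<omega>\<in>space M. Sup ((\<lambda>t. X t \<omega>) ` {0..er \<omega>}) > y}
                       = (1 - \<pi>S) * exp (- rS * y)"
  defines "EI \<equiv> (1 - \<pi>I) / rI" and "ES \<equiv> (1 - \<pi>S) / rS"
    and "FI \<equiv> (rI + rS) / (rI + \<pi>I * rS)" and "FS \<equiv> (rI + rS) / (\<pi>S * rI + rS)"
    and "GI \<equiv> (rI + rS) / (rI + \<pi>I * rS) - 1" and "GS \<equiv> (rI + rS) / (\<pi>S * rI + rS) - 1"
  shows "(\<exists>!u. u > 0 \<and>
            u - 2 * \<delta> - EI - ES
              = (- EI * FS * exp (rS * u) - ES * FI * exp (rI * u) + 2 * ES * FS * GI)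
                / (exp ((rI + rS) * u) - GI * GS))
       \<and> (\<forall>u. u > 0 \<and>
            u - 2 * \<delta> - EI - ES
              = (- EI * FS * exp (rS * u) - ES * FI * exp (rI * u) + 2 * ES * FS * GI)
                / (exp ((rI + rS) * u) - GI * GS)
          \<longrightarrow>
          (let AI = (- EI * exp (rS * u) + ES * GI) / (exp ((rI + rS) * u) - GI * GS);
               AS = (ES * exp (rI * u) - EI * GS) / (exp ((rI + rS) * u) - GI * GS);
               xI = - \<delta> - EI + FI * AS;
               xS = \<delta> + ES + FS * AI;
               V = (\<lambda>x. if x \<le> xI then x + \<delta>
                        else if x < xS then AI * exp (- rI * (x - xS)) + AS * exp (rS * (x - xI))
                        else x - \<delta>);
               ST = {\<tau>. stopping_time_ext F \<tau>};
               Mx = dynkin_M M X r (\<lambda>y. y - \<delta>) (\<lambda>y. y + \<delta>)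
           in xS - xI = u
              \<and> (\<forall>x. hit_below X x xI \<in> ST \<and> hit_above X x xS \<in> ST
                  \<and> V x = (INF \<sigma>\<in>ST. SUP \<tau>\<in>ST. Mx x \<sigma> \<tau>)
                  \<and> V x = (SUP \<tau>\<in>ST. INF \<sigma>\<in>ST. Mx x \<sigma> \<tau>)
                  \<and> V x = Mx x (hit_below X x xI) (hit_above X x xS))))"
proof -
  interpret S: exp_sup_levy M F X er r \<pi>S rS
    using levy r_pos er_exp er_indep rS_pos piS law_S by unfold_locales
  interpret I: killed_levy M F "\<lambda>t \<omega>. - X t \<omega>" er r by (rule S.killed_levy_uminus)
  have "Sup ((\<lambda>t. - X t \<omega>) ` {0..er \<omega>}) = - Inf ((\<lambda>t. X t \<omega>) ` {0..er \<omega>})" for \<omega>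
    by (simp add: Inf_real_def image_image)
  with law_I interpret game: exponential_dynkin_game rI rS \<pi>I \<pi>S \<delta> M F X er r
    using rI_pos rS_pos piI piS delta_pos cond1 cond2 by unfold_locales simp_all
  have constants: "EI = game.EI" "ES = game.ES" "FI = game.FI" "FS = game.FS"
      "GI = game.GI" "GS = game.GS"
    by (simp_all only: EI_def ES_def FI_def FS_def GI_def GS_def
        game.EI_def game.ES_def game.FI_def game.FS_def game.GI_def game.GS_def)
  show ?thesis
    unfolding constants Let_def game.gap_equation_iff game.AI_def[symmetric] game.AS_def[symmetric]
      game.xI_def[symmetric] game.xS_def[symmetric] game.game_value_def[symmetric]
    by (intro conjI allI impI game.ex1_gap game.game_value_saddle_point) auto
qed

end
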